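(* For every integer $n>1$, the simple context processor $SCP_n$ is a sound and complete CDP processor; that is, for every CDP problem $Prob$: if every problem in $SCP_n(Prob)$ is finite then $Prob$ is finite (soundness), and if some problem in $SCP_n(Prob)$ is infinite then $Prob$ is infinite (completeness).
   Context: Positions are finite sequences of positive integers; $\epsilon$ is the root; $q\le q'$ means $q$ is a prefix of $q'$, $q>q'$ strictly below, $q\parallel q'$ parallel (incomparable). A context $c[\Box]_p$ is a term with a single hole $\Box$ at position $p$; $c[u]_p$ fills the hole. A rule $l\to r$ overlaps a term $t$ at a non-variable position $p$ of $t$ if $l$ (renamed apart) and $t|_p$ unify. Forbidden patterns: triples $\langle t,p,\lambda\rangle$, $t$ a term, $p\in Pos(t)$, $\lambda\in\{h,b,a\}$. For a term $s$, $P_{t,p}(s)=\{o.p\mid s|_o=t\sigma$ for some $\sigma,o\}$; $P_\pi(s)$ is $\{o\mid\exists q\in P_{t,p}(s):o<q\}$ if $\lambda=a$, $\{o\mid \exists q\in P_{t,p}(s):o>q\}$ if $\lambda=b$, and $P_{t,p}(s)$ if $\lambda=h$. Forbidden positions of $s$ w.r.t. a set $\Pi$: $\bigcup_{\pi\in\Pi}P_\pi(s)$; the rest are allowed. A position is forbidden by a pattern $\pi$ if it lies in $P_\pi(s)$. $s\rightarrow_{\mathcal{R},\Pi}t$ is an $\mathcal{R}$-step at a position allowed in $s$. $\overset{\not\le p}{\to}$ denotes a step at a position strictly below or parallel to $p$. A term $s$ is $\Pi$-terminating in context $C[\Box]_p$ if $C[s]_p$ admits no infinite $\Pi$-reduction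 in which all contracted redexes are at, below or parallel to $p$ and infinitely many are at or below $p$. Marked symbols and $T$: for each function symbol $f$ there is a fresh marked symbol $f^{\#}$; $T$ is a fresh unary symbol. For a term $s$, $erase(s)$ replaces each $f^{\#}$ by $f$ and each subterm $T(s')$ by $s'$. A contextual rule $u\to v\,[c]$ ($c$ a context) used as rewrite rule means $u\to c[v]$; for a set $\mathcal{P}$ of such rules, $\rightarrow_\mathcal{P}$ is the induced rewrite relation. A CDP problem is a quadruple $(\mathcal{P},\mathcal{R},\Pi,T)$ with $\mathcal{P}$ a set of contextual rules (CDPs), $\mathcal{R}=(\mathcal{F},R)$ a TRS, $\Pi$ forbidden patterns over $\mathcal{F}$, $T\notin\mathcal{F}$ occurring only at the root of left- and right-hand sides of rules in $\mathcal{P}$. CDP chains: a sequence $s_1\to t_1[c_1[\Box]_{p_1}], s_2\to t_2[c_2[\Box]_{p_2}],\dots$ of elements of $\mathcal{P}$ (renamed variable-disjoint) is a CDP chain if there is a substitution $\sigma$ such that, with $p_0'=\epsilon$, $c_0''=\Box$, for all $i\ge1$: $c_{i-1}''[s_i\sigma]_{p_{i-1}'}\rightarrow_{\mathcal{P}} c_{i-1}''[c_i[t_i\sigma]_{p_i}]_{p_{i-1}'}=c_i'[t_i\sigma]_{p_i'}$ with $p_i'=p_{i-1}'.p_i$, $c_i'=c_{i-1}''[c_i]$, followed by $c_i'[t_i\sigma]_{p_i'}\overset{\not\le p_i'}{\rightarrow}{}^*_{\mathcal{R}} c_i''[s_{i+1}\sigma]_{p_i'}$, which is empty whenever $root(t_i)=T$;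 and every single step $s\overset{q}{\to}t$ (by $\mathcal{P}$ or $\mathcal{R}$) in the sequence has $q$ allowed in $erase(s)$ w.r.t. $\Pi$. The chain is minimal if for every $i$ every subterm of $c_i'[t_i\sigma]_{p_i'}$ at a position $q>p_i'$ is $\Pi$-terminating in its context w.r.t. $\mathcal{R}$. A CDP problem is finite if it admits no infinite minimal CDP chain, and infinite otherwise. A CDP processor is a function mapping CDP problems to sets of CDP problems. $\Pi_{orth}$: the set of patterns $\langle t,p,\lambda\rangle\in\Pi$ with $\lambda\in\{h,b\}$, $t$ linear, and $t$ not overlapped by any rule of $\mathcal{R}$ at any position parallel to or below $p$. Simple context processor: let $Prob=(\{s\to t[c[\Box]_p]\}\uplus\mathcal{P},\mathcal{R},\Pi,T)$ and $n$ a bound. $SCP_n(Prob)=\{(\mathcal{P},\mathcal{R},\Pi,T)\}$ if for every sequence of CDPs (of $Prob$) $s\to t[c[\Box]_p], s_2\to t_2[c_2[\Box]_{p_2}],\dots,s_n\to t_n[c_n[\Box]_{p_n}]$ the position $p.p_2.\cdots.p_n$ is forbidden in the term $c[c_2[\dots c_n[erase(t_n)]_{p_n}\dots]_{p_2}]_p$ by a forbidden pattern of $\Pi_{orth}$; and $SCP_n(Prob)=\{Prob\}$ otherwise. *)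

theory Defs
  imports Main "HOL-Library.Sublist" "HOL-Library.Infinite_Typeclass"
begin

subsection \<open>Terms, positions, contexts\<close>

datatype (funs_term: 'f, vars_term: 'v) "term" =
  Var 'v | Fun 'f "('f, 'v) term list"

datatype (funs_ctxt: 'f, vars_ctxt: 'v) ctxt =
  Hole | More 'f "('f, 'v) term list" "('f, 'v) ctxt" "('f, 'v) term list"

type_synonym ('f, 'v) subst = "'v \<Rightarrow> ('f, 'v) term"

text \<open>Argument positions are counted from 0.  The prefix order \<open>prefix\<close>, \<open>strict_prefix\<close> and
  incomparability \<open>\<parallel>\<close> of positions are those of \<^theory>\<open>HOL-Library.Sublist\<close>.\<close>

type_synonym pos = "nat list"

lemma size_nth_term [termination_simp]:
  "i < length ts \<Longrightarrow> size (ts ! i) < Suc (size_list size ts)"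
  by (meson less_Suc_eq_le nth_mem order_refl size_list_estimation')

fun poss :: "('f, 'v) term \<Rightarrow> pos set" where
  "poss (Var x) = {[]}"
| "poss (Fun f ts) = insert [] (\<Union>i < length ts. (#) i ` poss (ts ! i))"

fun subt_at :: "('f, 'v) term \<Rightarrow> pos \<Rightarrow> ('f, 'v) term" (infixl "|'_" 67) where
  "s |_ [] = s"
| "Fun f ts |_ (i # p) = (ts ! i) |_ p"
| "Var x |_ (i # p) = undefined"

fun subst_apply :: "('f, 'v) term \<Rightarrow> ('f, 'v) subst \<Rightarrow> ('f, 'v) term" (infixl "\<cdot>" 67) where
  "Var x \<cdot> \<sigma> = \<sigma> x"
| "Fun f ts \<cdot> \<sigma> = Fun f (map (\<lambda>t. t \<cdot> \<sigma>) ts)"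

fun ctxt_apply :: "('f, 'v) ctxt \<Rightarrow> ('f, 'v) term \<Rightarrow> ('f, 'v) term" ("_\<langle>_\<rangle>" [1000, 0] 1000) where
  "Hole\<langle>s\<rangle> = s"
| "(More f ss C ts)\<langle>s\<rangle> = Fun f (ss @ C\<langle>s\<rangle> # ts)"

fun hole_pos :: "('f, 'v) ctxt \<Rightarrow> pos" where
  "hole_pos Hole = []"
| "hole_pos (More f ss C ts) = length ss # hole_pos C"

fun ctxt_comp :: "('f, 'v) ctxt \<Rightarrow> ('f, 'v) ctxt \<Rightarrow> ('f, 'v) ctxt" (infixl "\<circ>\<^sub>c" 75) where
  "Hole \<circ>\<^sub>c D = D"
| "More f ss C ts \<circ>\<^sub>c D = More f ss (C \<circ>\<^sub>c D) ts"

fun ctxt_subst :: "('f, 'v) ctxt \<Rightarrow> ('f, 'v) subst \<Rightarrow> ('f, 'v) ctxt" (infixl "\<cdot>\<^sub>c" 67) where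
  "Hole \<cdot>\<^sub>c \<sigma> = Hole"
| "More f ss C ts \<cdot>\<^sub>c \<sigma> = More f (map (\<lambda>t. t \<cdot> \<sigma>) ss) (C \<cdot>\<^sub>c \<sigma>) (map (\<lambda>t. t \<cdot> \<sigma>) ts)"

fun funas_term :: "('f, 'v) term \<Rightarrow> ('f \<times> nat) set" where
  "funas_term (Var x) = {}"
| "funas_term (Fun f ts) = insert (f, length ts) (\<Union>t \<in> set ts. funas_term t)"

fun funas_ctxt :: "('f, 'v) ctxt \<Rightarrow> ('f \<times> nat) set" where
  "funas_ctxt Hole = {}"
| "funas_ctxt (More f ss C ts) =
     insert (f, Suc (length ss + length ts))
       (funas_ctxt C \<union> (\<Union>t \<in> set ss \<union> set ts. funas_term t))"

definition linear_term :: "('f, 'v) term \<Rightarrow> bool" where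
  "linear_term t \<longleftrightarrow>
     (\<forall>p \<in> poss t. \<forall>q \<in> poss t. \<forall>x. t |_ p = Var x \<and> t |_ q = Var x \<longrightarrow> p = q)"


subsection \<open>Rewriting with forbidden patterns\<close>

type_synonym ('f, 'v) rule = "('f, 'v) term \<times> ('f, 'v) term"

definition rstep_at ::
  "('f, 'v) rule set \<Rightarrow> pos \<Rightarrow> ('f, 'v) term \<Rightarrow> ('f, 'v) term \<Rightarrow> bool" where
  "rstep_at R q s t \<longleftrightarrow>
     (\<exists>l r C \<sigma>. (l, r) \<in> R \<and> hole_pos C = q \<and> s = C\<langle>l \<cdot> \<sigma>\<rangle> \<and> t = C\<langle>r \<cdot> \<sigma>\<rangle>)"

definition overlaps_at :: "('f, 'v) rule \<Rightarrow> ('f, 'v) term \<Rightarrow> pos \<Rightarrow> bool" where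
  "overlaps_at rl t q \<longleftrightarrow>
     q \<in> poss t \<and> (\<nexists>x. t |_ q = Var x) \<and>
     (\<exists>\<rho>. bij \<rho> \<and> vars_term (map_term id \<rho> (fst rl)) \<inter> vars_term t = {} \<and>
          (\<exists>\<mu>. map_term id \<rho> (fst rl) \<cdot> \<mu> = (t |_ q) \<cdot> \<mu>))"

datatype flag = Here | Below | Above

type_synonym ('f, 'v) pattern = "('f, 'v) term \<times> pos \<times> flag"

definition match_poss :: "('f, 'v) term \<Rightarrow> pos \<Rightarrow> ('f, 'v) term \<Rightarrow> pos set" where
  "match_poss t p s = {q @ p | q. q \<in> poss s \<and> (\<exists>\<sigma>. s |_ q = t \<cdot> \<sigma>)}"

fun pattern_poss :: "('f, 'v) pattern \<Rightarrow> ('f, 'v) term \<Rightarrow> pos set" where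
  "pattern_poss (t, p, Here) s = match_poss t p s"
| "pattern_poss (t, p, Below) s = {q'. \<exists>q \<in> match_poss t p s. strict_prefix q q'}"
| "pattern_poss (t, p, Above) s = {q'. \<exists>q \<in> match_poss t p s. strict_prefix q' q}"

definition forbidden :: "('f, 'v) pattern set \<Rightarrow> ('f, 'v) term \<Rightarrow> pos set" where
  "forbidden \<Pi> s = (\<Union>\<pi> \<in> \<Pi>. pattern_poss \<pi> s)"

definition allowed :: "('f, 'v) pattern set \<Rightarrow> ('f, 'v) term \<Rightarrow> pos set" where
  "allowed \<Pi> s = poss s - forbidden \<Pi> s"

definition pi_terminating_in ::
  "('f, 'v) rule set \<Rightarrow> ('f, 'v) pattern set \<Rightarrow> ('f, 'v) ctxt \<Rightarrow> ('f, 'v) term \<Rightarrow> bool" where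
  "pi_terminating_in R \<Pi> C s \<longleftrightarrow>
     \<not> (\<exists>u q. u 0 = C\<langle>s\<rangle> \<and>
          (\<forall>i::nat. rstep_at R (q i) (u i) (u (Suc i)) \<and> q i \<in> allowed \<Pi> (u i) \<and>
                    (prefix (hole_pos C) (q i) \<or> hole_pos C \<parallel> q i)) \<and>
          infinite {i. prefix (hole_pos C) (q i)})"

definition orth_patterns ::
  "('f, 'v) rule set \<Rightarrow> ('f, 'v) pattern set \<Rightarrow> ('f, 'v) pattern set" where
  "orth_patterns R \<Pi> =
     {(t, p, k) \<in> \<Pi>. k \<in> {Here, Below} \<and> linear_term t \<and>
        \<not> (\<exists>rl \<in> R. \<exists>q. (q \<parallel> p \<or> strict_prefix p q) \<and> overlaps_at rl t q)}"


subsection \<open>Contextual dependency pair problems\<close>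

text \<open>\<open>Mark f\<close> is the marked symbol of \<open>f\<close>.  The token symbol of a problem is given by some
  \<open>T :: 'f\<close> not occurring in the signature, and is used as \<open>Sym T\<close>.\<close>

datatype 'f sym = Sym 'f | Mark 'f

fun unmark :: "'f sym \<Rightarrow> 'f sym" where
  "unmark (Sym f) = Sym f"
| "unmark (Mark f) = Sym f"

fun erase :: "'f \<Rightarrow> ('f sym, 'v) term \<Rightarrow> ('f sym, 'v) term" where
  "erase T (Var x) = Var x"
| "erase T (Fun g ts) =
     (if g = Sym T \<and> length ts = 1 then hd (map (erase T) ts)
      else Fun (unmark g) (map (erase T) ts))"

text \<open>The contextual rule \<open>u \<rightarrow> v [c]\<close> is the triple \<open>(u, v, c)\<close>; the position of the hole is
  \<open>hole_pos c\<close>.\<close>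

type_synonym ('f, 'v) cdp = "('f sym, 'v) term \<times> ('f sym, 'v) term \<times> ('f sym, 'v) ctxt"

abbreviation cdp_lhs :: "('f, 'v) cdp \<Rightarrow> ('f sym, 'v) term" where
  "cdp_lhs \<alpha> \<equiv> fst \<alpha>"

abbreviation cdp_rhs :: "('f, 'v) cdp \<Rightarrow> ('f sym, 'v) term" where
  "cdp_rhs \<alpha> \<equiv> fst (snd \<alpha>)"

abbreviation cdp_ctxt :: "('f, 'v) cdp \<Rightarrow> ('f sym, 'v) ctxt" where
  "cdp_ctxt \<alpha> \<equiv> snd (snd \<alpha>)"

definition vars_cdp :: "('f, 'v) cdp \<Rightarrow> 'v set" where
  "vars_cdp \<alpha> = vars_term (cdp_lhs \<alpha>) \<union> vars_term (cdp_rhs \<alpha>) \<union> vars_ctxt (cdp_ctxt \<alpha>)"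

definition cdp_variant :: "('f, 'v) cdp \<Rightarrow> ('f, 'v) cdp \<Rightarrow> bool" where
  "cdp_variant \<alpha> \<beta> \<longleftrightarrow>
     (\<exists>\<rho>. bij \<rho> \<and>
        \<beta> = (map_term id \<rho> (cdp_lhs \<alpha>), map_term id \<rho> (cdp_rhs \<alpha>), map_ctxt id \<rho> (cdp_ctxt \<alpha>)))"

type_synonym ('f, 'v) trs = "('f \<times> nat) set \<times> ('f sym, 'v) rule set"

type_synonym ('f, 'v) cdp_problem =
  "('f, 'v) cdp set \<times> ('f, 'v) trs \<times> ('f sym, 'v) pattern set \<times> 'f"

definition base_sig :: "('f \<times> nat) set \<Rightarrow> ('f sym \<times> nat) set" where
  "base_sig F = {(Sym f, n) | f n. (f, n) \<in> F}"

definition ext_sig :: "('f \<times> nat) set \<Rightarrow> 'f \<Rightarrow> ('f sym \<times> nat) set" where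
  "ext_sig F T = base_sig F \<union> {(Mark f, n) | f n. (f, n) \<in> F} \<union> {(Sym T, 1)}"

definition trs :: "('f, 'v) trs \<Rightarrow> bool" where
  "trs \<R> \<longleftrightarrow>
     (\<forall>(l, r) \<in> snd \<R>. (\<nexists>x. l = Var x) \<and> vars_term r \<subseteq> vars_term l \<and>
        funas_term l \<subseteq> base_sig (fst \<R>) \<and> funas_term r \<subseteq> base_sig (fst \<R>))"

definition root_is :: "'f \<Rightarrow> ('f sym, 'v) term \<Rightarrow> bool" where
  "root_is T t \<longleftrightarrow> (\<exists>ts. t = Fun (Sym T) ts)"

definition only_at_root :: "'f \<Rightarrow> ('f sym, 'v) term \<Rightarrow> bool" where
  "only_at_root T t \<longleftrightarrow> (\<forall>q \<in> poss t. q \<noteq> [] \<longrightarrow> \<not> root_is T (t |_ q))"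

fun cdp_problem :: "('f, 'v) cdp_problem \<Rightarrow> bool" where
  "cdp_problem (P, (F, R), \<Pi>, T) \<longleftrightarrow>
     trs (F, R) \<and>
     (\<forall>(t, p, k) \<in> \<Pi>. funas_term t \<subseteq> base_sig F \<and> p \<in> poss t) \<and>
     T \<notin> fst ` F \<and>
     (\<forall>(u, v, c) \<in> P.
        funas_term u \<subseteq> ext_sig F T \<and> funas_term v \<subseteq> ext_sig F T \<and> funas_ctxt c \<subseteq> ext_sig F T \<and>
        only_at_root T u \<and> only_at_root T v \<and> Sym T \<notin> funs_ctxt c)"


subsection \<open>Infinite minimal chains, finiteness, processors\<close>

definition chain_rsteps ::
  "('f sym, 'v) rule set \<Rightarrow> ('f sym, 'v) pattern set \<Rightarrow> 'f \<Rightarrow> pos \<Rightarrow> ('f sym, 'v) term rel" where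
  "chain_rsteps R \<Pi> T p =
     {(s, t). \<exists>q. rstep_at R q s t \<and> (strict_prefix p q \<or> q \<parallel> p) \<and> q \<in> allowed \<Pi> (erase T s)}"

text \<open>The chain is \<open>\<alpha> 0, \<alpha> 1, \<dots>\<close>.  The context \<open>D i\<close> surrounds the left-hand side of \<open>\<alpha> i\<close> when
  this rule is applied (\<open>D 0 = Hole\<close>), and \<open>D i \<circ>\<^sub>c (c\<^sub>i \<cdot>\<^sub>c \<sigma>)\<close> surrounds its right-hand side
  afterwards.\<close>

fun cdp_chain_with ::
  "('f, 'v) cdp_problem \<Rightarrow> (nat \<Rightarrow> ('f, 'v) cdp) \<Rightarrow> ('f sym, 'v) subst \<Rightarrow>
   (nat \<Rightarrow> ('f sym, 'v) ctxt) \<Rightarrow> bool" where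
  "cdp_chain_with (P, (F, R), \<Pi>, T) \<alpha> \<sigma> D \<longleftrightarrow>
     (\<forall>i. \<exists>\<beta> \<in> P. cdp_variant \<beta> (\<alpha> i)) \<and>
     (\<forall>i j. i \<noteq> j \<longrightarrow> vars_cdp (\<alpha> i) \<inter> vars_cdp (\<alpha> j) = {}) \<and>
     (\<forall>x. funas_term (\<sigma> x) \<subseteq> ext_sig F T) \<and>
     D 0 = Hole \<and>
     (\<forall>i. let C = D i \<circ>\<^sub>c (cdp_ctxt (\<alpha> i) \<cdot>\<^sub>c \<sigma>);
              s = C\<langle>cdp_rhs (\<alpha> i) \<cdot> \<sigma>\<rangle>;
              s' = (D (Suc i))\<langle>cdp_lhs (\<alpha> (Suc i)) \<cdot> \<sigma>\<rangle>
          in hole_pos (D i) \<in> allowed \<Pi> (erase T ((D i)\<langle>cdp_lhs (\<alpha> i) \<cdot> \<sigma>\<rangle>)) \<and>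
             hole_pos (D (Suc i)) = hole_pos C \<and>
             (s, s') \<in> (chain_rsteps R \<Pi> T (hole_pos C))\<^sup>* \<and>
             (root_is T (cdp_rhs (\<alpha> i)) \<longrightarrow> s = s'))"

fun minimal_with ::
  "('f, 'v) cdp_problem \<Rightarrow> (nat \<Rightarrow> ('f, 'v) cdp) \<Rightarrow> ('f sym, 'v) subst \<Rightarrow>
   (nat \<Rightarrow> ('f sym, 'v) ctxt) \<Rightarrow> bool" where
  "minimal_with (P, (F, R), \<Pi>, T) \<alpha> \<sigma> D \<longleftrightarrow>
     (\<forall>i. let C = D i \<circ>\<^sub>c (cdp_ctxt (\<alpha> i) \<cdot>\<^sub>c \<sigma>)
          in \<forall>E u. E\<langle>u\<rangle> = C\<langle>cdp_rhs (\<alpha> i) \<cdot> \<sigma>\<rangle> \<and> strict_prefix (hole_pos C) (hole_pos E) \<longrightarrow>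
                   pi_terminating_in R \<Pi> E u)"

definition infinite_minimal_chain ::
  "('f, 'v) cdp_problem \<Rightarrow> (nat \<Rightarrow> ('f, 'v) cdp) \<Rightarrow> bool" where
  "infinite_minimal_chain X \<alpha> \<longleftrightarrow> (\<exists>\<sigma> D. cdp_chain_with X \<alpha> \<sigma> D \<and> minimal_with X \<alpha> \<sigma> D)"

definition finite_problem :: "('f, 'v) cdp_problem \<Rightarrow> bool" where
  "finite_problem X \<longleftrightarrow> (\<nexists>\<alpha>. infinite_minimal_chain X \<alpha>)"

definition infinite_problem :: "('f, 'v) cdp_problem \<Rightarrow> bool" where
  "infinite_problem X \<longleftrightarrow> \<not> finite_problem X"

type_synonym ('f, 'v) processor = "('f, 'v) cdp_problem \<Rightarrow> ('f, 'v) cdp_problem set"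

definition cdp_processor :: "('f, 'v) processor \<Rightarrow> bool" where
  "cdp_processor Proc \<longleftrightarrow> (\<forall>X. cdp_problem X \<longrightarrow> (\<forall>Y \<in> Proc X. cdp_problem Y))"

definition sound_processor :: "('f, 'v) processor \<Rightarrow> bool" where
  "sound_processor Proc \<longleftrightarrow>
     (\<forall>X. cdp_problem X \<longrightarrow> (\<forall>Y \<in> Proc X. finite_problem Y) \<longrightarrow> finite_problem X)"

definition complete_processor :: "('f, 'v) processor \<Rightarrow> bool" where
  "complete_processor Proc \<longleftrightarrow>
     (\<forall>X. cdp_problem X \<longrightarrow> (\<exists>Y \<in> Proc X. infinite_problem Y) \<longrightarrow> infinite_problem X)"


subsection \<open>The simple context processor\<close>

definition compose_ctxts :: "('f, 'v) cdp list \<Rightarrow> ('f sym, 'v) ctxt" where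
  "compose_ctxts \<alpha>s = foldr (\<lambda>\<alpha> C. cdp_ctxt \<alpha> \<circ>\<^sub>c C) \<alpha>s Hole"

fun scp_applicable :: "nat \<Rightarrow> ('f, 'v) cdp \<Rightarrow> ('f, 'v) cdp_problem \<Rightarrow> bool" where
  "scp_applicable n \<alpha> (P, (F, R), \<Pi>, T) \<longleftrightarrow>
     (\<forall>\<alpha>s. length \<alpha>s = n \<and> set \<alpha>s \<subseteq> P \<and> hd \<alpha>s = \<alpha> \<longrightarrow>
        hole_pos (compose_ctxts \<alpha>s)
          \<in> forbidden (orth_patterns R \<Pi>) ((compose_ctxts \<alpha>s)\<langle>erase T (cdp_rhs (last \<alpha>s))\<rangle>))"

text \<open>The CDP to be removed is a parameter of the processor; \<open>sel\<close> chooses it for every problem.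
  If the chosen triple is not a CDP of the problem, the problem is returned unchanged.\<close>

fun SCP :: "nat \<Rightarrow> (('f, 'v) cdp_problem \<Rightarrow> ('f, 'v) cdp) \<Rightarrow> ('f, 'v) processor" where
  "SCP n sel (P, \<R>, \<Pi>, T) =
     (let \<alpha> = sel (P, \<R>, \<Pi>, T)
      in if \<alpha> \<in> P \<and> scp_applicable n \<alpha> (P, \<R>, \<Pi>, T) then {(P - {\<alpha>}, \<R>, \<Pi>, T)}
         else {(P, \<R>, \<Pi>, T)})"

end

theory Submission
  imports Defs
begin

text \<open>No infinite chain contains a variant of the removed CDP.  After \<open>n\<close> consecutive steps starting
  with it, the pattern of \<open>\<Pi>\<^sub>o\<^sub>r\<^sub>t\<^sub>h\<close> that forbids the position of the next CDP in the composed
  contexts still matches in the actual term: all intermediate \<open>R\<close>-steps are below or parallel to that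
  position, where by orthogonality no redex overlaps the linear pattern, so they act inside
  substitution parts of the match.  Hence the next CDP step would be at a forbidden position.\<close>

subsection \<open>Contexts and positions\<close>

text \<open>The obstacle is erasing. Allowedness is read off the erased term, whereas the steps take
  place in the unerased one. The substitution of a chain may carry marks and \<open>T\<close>, so
  erasing can shift positions and does not commute with rewriting. The match is therefore followed
  in unerased contexts whose hole holds an erased or unmarked version of the actual content; the
  passage to the erasure of the whole term is made only once, at the end. It succeeds because
  \<open>T\<close> never lies on the path to the hole, and because patterns are built over the
  signature \<open>F\<close>, so that the function symbols of a match are neither marked nor
  \<open>T\<close>.\<close>

lemma ctxt_comp_apply [simp]: "(C \<circ>\<^sub>c D)\<langle>s\<rangle> = C\<langle>D\<langle>s\<rangle>\<rangle>"
  by (induction C) auto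

lemma hole_pos_comp [simp]: "hole_pos (C \<circ>\<^sub>c D) = hole_pos C @ hole_pos D"
  by (induction C) auto

lemma hole_pos_subst [simp]: "hole_pos (C \<cdot>\<^sub>c \<sigma>) = hole_pos C"
  by (induction C) auto

lemma hole_pos_map [simp]: "hole_pos (map_ctxt f g C) = hole_pos C"
  by (induction C) auto

lemma ctxt_comp_assoc: "(C \<circ>\<^sub>c D) \<circ>\<^sub>c E = C \<circ>\<^sub>c (D \<circ>\<^sub>c E)"
  by (induction C) auto

lemma ctxt_comp_Hole [simp]: "C \<circ>\<^sub>c Hole = C"
  by (induction C) auto

lemma Nil_in_poss [simp]: "[] \<in> poss s"
  by (cases s) auto

lemma hole_pos_in_poss [simp]: "hole_pos C \<in> poss C\<langle>s\<rangle>"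
  by (induction C) (auto simp: nth_append)

lemma subt_at_ctxt_append [simp]: "C\<langle>s\<rangle> |_ (hole_pos C @ q) = s |_ q"
  by (induction C) auto

lemma subt_at_hole_pos [simp]: "C\<langle>s\<rangle> |_ hole_pos C = s"
  using subt_at_ctxt_append[of C s "[]"] by simp

lemma poss_ctxt_append: "hole_pos C @ q \<in> poss C\<langle>s\<rangle> \<longleftrightarrow> q \<in> poss s"
  by (induction C) (auto simp: image_iff nth_append)

lemma ctxt_of_poss:
  assumes "q \<in> poss s"
  obtains C where "hole_pos C = q" "s = C\<langle>s |_ q\<rangle>"
  using assms
proof (induction q arbitrary: s thesis)
  case Nil
  then show ?case by (metis ctxt_apply.simps(1) hole_pos.simps(1) subt_at.simps(1))
next
  case (Cons i q)
  from Cons.prems(2) obtain f ts where s: "s = Fun f ts" and i: "i < length ts" and q: "q \<in> poss (ts ! i)"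
    by (cases s) auto
  obtain C where C: "hole_pos C = q" "ts ! i = C\<langle>(ts ! i) |_ q\<rangle>"
    using Cons.IH[OF _ q] by blast
  show ?case
    by (rule Cons.prems(1)[of "More f (take i ts) C (drop (Suc i) ts)"])
      (use C i s in \<open>auto simp: id_take_nth_drop[symmetric]\<close>)
qed

lemma ctxt_eq_same_pos:
  assumes "C\<langle>s\<rangle> = D\<langle>u\<rangle>" "hole_pos C = hole_pos D"
  shows "C = D \<and> s = u"
  using assms
proof (induction C arbitrary: D)
  case Hole
  then show ?case by (cases D) auto
next
  case (More f ss C ts)
  then show ?case by (cases D) auto
qed

lemma ctxt_eq_below:
  assumes "C\<langle>s\<rangle> = E\<langle>a\<rangle>" "prefix (hole_pos C) (hole_pos E)"
  obtains E' where "E = C \<circ>\<^sub>c E'" "s = E'\<langle>a\<rangle>"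
  using assms
proof (induction C arbitrary: E thesis)
  case Hole
  then show ?case by auto
next
  case (More f ss C ts)
  from More.prems(2,3) obtain ss' E1 ts' where E: "E = More f ss' E1 ts'" and len: "length ss = length ss'"
    by (cases E) auto
  have eq: "ss = ss'" "ts = ts'" "C\<langle>s\<rangle> = E1\<langle>a\<rangle>" using More.prems(2) len E by auto
  obtain E' where "E1 = C \<circ>\<^sub>c E'" "s = E'\<langle>a\<rangle>"
    using More.IH[OF _ eq(3)] More.prems(3) E by auto
  then show ?case using More.prems(1)[of E'] E eq by auto
qed

lemma ctxt_split:
  assumes "prefix r (hole_pos C)"
  obtains C1 C2 where "C = C1 \<circ>\<^sub>c C2" "hole_pos C1 = r"
  using assms
proof (induction r arbitrary: C thesis)
  case Nil
  then show ?case using Nil.prems(1)[of Hole C] by simp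
next
  case (Cons i r)
  from Cons.prems(2) obtain f ss C' ts where C: "C = More f ss C' ts" "i = length ss" "prefix r (hole_pos C')"
    by (cases C) auto
  obtain C1 C2 where "C' = C1 \<circ>\<^sub>c C2" "hole_pos C1 = r" using Cons.IH[OF _ C(3)] by blast
  then show ?case using Cons.prems(1)[of "More f ss C1 ts" C2] C by simp
qed

text \<open>Only the symbols on the path to the hole decide whether erasing moves the hole.
  Occurrences of \<open>T\<close> beside the path, brought in by the substitution, do no harm, so
  \<open>funs_ctxt\<close> would be too coarse.\<close>

fun spine :: "('f, 'v) ctxt \<Rightarrow> 'f list" where
  "spine Hole = []"
| "spine (More f ss C ts) = f # spine C"

lemma spine_comp [simp]: "spine (C \<circ>\<^sub>c D) = spine C @ spine D"
  by (induction C) auto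

lemma spine_subst [simp]: "spine (C \<cdot>\<^sub>c \<sigma>) = spine C"
  by (induction C) auto

lemma set_spine: "set (spine C) \<subseteq> funs_ctxt C"
  by (induction C) auto

text \<open>The last clause expresses that a replacement parallel to the hole is independent of the
  hole content. It is what later allows a step to be repeated with a different content.\<close>

lemma ctxt_eq_parallel:
  assumes "C\<langle>s\<rangle> = E\<langle>a\<rangle>" "hole_pos C \<parallel> hole_pos E"
  obtains C' where "hole_pos C' = hole_pos C" "spine C' = spine C" "E\<langle>b\<rangle> = C'\<langle>s\<rangle>"
    "\<And>X. \<exists>E'. hole_pos E' = hole_pos E \<and> C\<langle>X\<rangle> = E'\<langle>a\<rangle> \<and> C'\<langle>X\<rangle> = E'\<langle>b\<rangle>"
  using assms
proof (induction C arbitrary: E thesis)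
  case Hole
  then show ?case by (auto simp: parallel_def)
next
  case (More f ss C ts)
  from More.prems(2,3) obtain ss' E1 ts' where E: "E = More f ss' E1 ts'"
    by (cases E) (auto simp: parallel_def)
  have eq: "ss @ C\<langle>s\<rangle> # ts = ss' @ E1\<langle>a\<rangle> # ts'" using More.prems(2) E by simp
  consider (same) "length ss = length ss'" | (left) "length ss < length ss'"
    | (right) "length ss > length ss'"
    by linarith
  then show ?case
  proof cases
    case same
    with eq have e: "ss = ss'" "ts = ts'" "C\<langle>s\<rangle> = E1\<langle>a\<rangle>" by auto
    have "hole_pos C \<parallel> hole_pos E1"
      using More.prems(3) E same by (auto simp: parallel_def)
    from More.IH[OF _ e(3) this] obtain C' where C': "hole_pos C' = hole_pos C"
      "spine C' = spine C" "E1\<langle>b\<rangle> = C'\<langle>s\<rangle>"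
      "\<And>X. \<exists>E'. hole_pos E' = hole_pos E1 \<and> C\<langle>X\<rangle> = E'\<langle>a\<rangle> \<and> C'\<langle>X\<rangle> = E'\<langle>b\<rangle>" by blast
    have ex: "\<exists>E'. hole_pos E' = hole_pos E \<and> (More f ss C ts)\<langle>X\<rangle> = E'\<langle>a\<rangle> \<and>
        (More f ss C' ts)\<langle>X\<rangle> = E'\<langle>b\<rangle>" for X
    proof -
      obtain E' where "hole_pos E' = hole_pos E1" "C\<langle>X\<rangle> = E'\<langle>a\<rangle>" "C'\<langle>X\<rangle> = E'\<langle>b\<rangle>"
        using C'(4) by blast
      then show ?thesis by (intro exI[of _ "More f ss E' ts"]) (auto simp: E e)
    qed
    show ?thesis by (rule More.prems(1)[OF _ _ _ ex]) (simp_all add: C'(1-3) E e)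
  next
    case left
    then obtain us where us: "ss' = ss @ C\<langle>s\<rangle> # us" "ts = us @ E1\<langle>a\<rangle> # ts'"
      using eq by (fastforce simp: append_eq_append_conv2 Cons_eq_append_conv append_eq_Cons_conv)
    have ex: "\<exists>E'. hole_pos E' = hole_pos E \<and> (More f ss C ts)\<langle>X\<rangle> = E'\<langle>a\<rangle> \<and>
        (More f ss C (us @ E1\<langle>b\<rangle> # ts'))\<langle>X\<rangle> = E'\<langle>b\<rangle>" for X
      by (intro exI[of _ "More f (ss @ C\<langle>X\<rangle> # us) E1 ts'"]) (auto simp: E us)
    show ?thesis by (rule More.prems(1)[OF _ _ _ ex]) (simp_all add: E us)
  next
    case right
    then obtain us where us: "ss = ss' @ E1\<langle>a\<rangle> # us" "ts' = us @ C\<langle>s\<rangle> # ts"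
      using eq by (fastforce simp: append_eq_append_conv2 Cons_eq_append_conv append_eq_Cons_conv)
    have ex: "\<exists>E'. hole_pos E' = hole_pos E \<and> (More f ss C ts)\<langle>X\<rangle> = E'\<langle>a\<rangle> \<and>
        (More f (ss' @ E1\<langle>b\<rangle> # us) C ts)\<langle>X\<rangle> = E'\<langle>b\<rangle>" for X
      by (intro exI[of _ "More f ss' E1 (us @ C\<langle>X\<rangle> # ts)"]) (auto simp: E us)
    show ?thesis by (rule More.prems(1)[OF _ _ _ ex]) (simp_all add: E us)
  qed
qed


subsection \<open>The skeleton order\<close>

text \<open>For linear \<open>s\<close>, \<open>s \<sqsubseteq> t\<close> says that \<open>t\<close> is an instance of \<open>s\<close>; in general different occurrences
  of a variable of \<open>s\<close> may correspond to different subterms of \<open>t\<close>.  Thus the order does not see that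
  the CDPs of a chain are renamed apart while the applicability condition shares their variables.\<close>

inductive skel_le :: "('f, 'v) term \<Rightarrow> ('f, 'w) term \<Rightarrow> bool" (infix "\<sqsubseteq>" 50) where
  Var: "Var x \<sqsubseteq> t"
| Fun: "length ss = length ts \<Longrightarrow> (\<And>i. i < length ss \<Longrightarrow> ss ! i \<sqsubseteq> ts ! i) \<Longrightarrow> Fun f ss \<sqsubseteq> Fun f ts"

inductive_simps skel_le_Fun_iff: "Fun f ss \<sqsubseteq> t"
inductive_simps skel_le_Fun_Fun_iff: "Fun f ss \<sqsubseteq> Fun g ts"

declare skel_le.Var [simp]

lemma skel_le_trans:
  assumes "s \<sqsubseteq> t" "t \<sqsubseteq> u"
  shows "s \<sqsubseteq> u"
  using assms
proof (induction arbitrary: u)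
  case (Fun ss ts f)
  then show ?case by (auto simp: skel_le_Fun_iff)
qed simp

lemma skel_le_refl [simp]: "s \<sqsubseteq> s"
  by (induction s) (auto intro: skel_le.Fun)

lemma skel_le_subst [simp]: "s \<sqsubseteq> s \<cdot> \<sigma>"
  by (induction s) (auto intro!: skel_le.Fun)

lemma skel_le_map:
  assumes "s \<sqsubseteq> t"
  shows "map_term f g s \<sqsubseteq> map_term f h t"
  using assms by induction (auto intro!: skel_le.Fun)

lemma skel_le_ctxt_subst:
  assumes "s \<sqsubseteq> t"
  shows "C\<langle>s\<rangle> \<sqsubseteq> (C \<cdot>\<^sub>c \<sigma>)\<langle>t\<rangle>"
  using assms by (induction C) (auto intro!: skel_le.Fun simp: nth_append nth_Cons')

lemma skel_le_subt_at:
  assumes "s \<sqsubseteq> t" "q \<in> poss s"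
  shows "q \<in> poss t \<and> s |_ q \<sqsubseteq> t |_ q"
  using assms
proof (induction arbitrary: q)
  case (Var x t)
  then show ?case by (cases t) auto
next
  case (Fun ss ts f)
  then show ?case by (cases q) (auto simp: image_iff intro: skel_le.Fun)
qed

text \<open>A hole that is not at a function position of \<open>t\<close> lies at or below a
  variable of \<open>t\<close>, where the order demands nothing. Other occurrences of that variable
  need not change along, as the order does not compare them.\<close>

lemma skel_le_ctxt_irrelevant:
  assumes "t \<sqsubseteq> C\<langle>a\<rangle>" "hole_pos C \<notin> poss t \<or> (\<exists>x. t |_ hole_pos C = Var x)"
  shows "t \<sqsubseteq> C\<langle>b\<rangle>"
  using assms
proof (induction C arbitrary: t)
  case Hole
  then show ?case by (cases t) auto
next
  case (More f ss C ts)
  show ?case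
  proof (cases t)
    case (Var x)
    then show ?thesis by simp
  next
    case (Fun g us)
    have len: "length us = Suc (length ss + length ts)" and g: "g = f"
      and us: "\<And>i. i < length us \<Longrightarrow> us ! i \<sqsubseteq> (ss @ C\<langle>a\<rangle> # ts) ! i"
      using More.prems(1) Fun by (auto simp: skel_le_Fun_Fun_iff)
    have "us ! length ss \<sqsubseteq> C\<langle>b\<rangle>"
    proof (rule More.IH)
      show "us ! length ss \<sqsubseteq> C\<langle>a\<rangle>" using us[of "length ss"] len by simp
      show "hole_pos C \<notin> poss (us ! length ss) \<or>
          (\<exists>x. us ! length ss |_ hole_pos C = Var x)"
        using More.prems(2) Fun len by auto
    qed
    then have "us ! i \<sqsubseteq> (ss @ C\<langle>b\<rangle> # ts) ! i" if "i < length us" for i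
      using us[OF that] by (auto simp: nth_append nth_Cons' split: if_splits)
    then show ?thesis using Fun g len by (auto intro!: skel_le.Fun)
  qed
qed

lemma subst_of_skel_le:
  assumes "t \<sqsubseteq> s" "\<And>p x. p \<in> poss t \<Longrightarrow> t |_ p = Var x \<Longrightarrow> \<tau> x = s |_ p"
  shows "s = t \<cdot> \<tau>"
  using assms
proof (induction)
  case (Var x t)
  then show ?case using Var[of "[]" x] by simp
next
  case (Fun ss ts f)
  have "ts ! i = ss ! i \<cdot> \<tau>" if "i < length ss" for i
    using Fun.IH[OF that] Fun.prems[of "i # _"] that by auto
  then show ?case using Fun.hyps by (auto intro: nth_equalityI)
qed

lemma linear_skel_le_instance:
  assumes "linear_term t" "t \<sqsubseteq> s"
  shows "\<exists>\<tau>. s = t \<cdot> \<tau>"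
proof -
  \<comment> \<open>Linearity makes the chosen position the only occurrence of \<open>x\<close>, so
    the choice agrees with every occurrence that \<open>subst_of_skel_le\<close> asks about.\<close>
  define \<tau> where "\<tau> x = s |_ (SOME p. p \<in> poss t \<and> t |_ p = Var x)" for x
  have "\<tau> x = s |_ p" if "p \<in> poss t" "t |_ p = Var x" for p x
  proof -
    have "(SOME p. p \<in> poss t \<and> t |_ p = Var x) = p"
      by (rule some_equality) (use that assms(1) in \<open>auto simp: linear_term_def\<close>)
    then show ?thesis by (simp add: \<tau>_def)
  qed
  then show ?thesis using subst_of_skel_le[OF assms(2)] by blast
qed

lemma linear_subt_at:
  assumes "linear_term t" "q \<in> poss t"
  shows "linear_term (t |_ q)"
proof -
  obtain C where C: "hole_pos C = q" "t = C\<langle>t |_ q\<rangle>" using ctxt_of_poss[OF assms(2)] .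
  have "q @ p \<in> poss t" "t |_ (q @ p) = t |_ q |_ p" if "p \<in> poss (t |_ q)" for p
    using C that poss_ctxt_append[of C p "t |_ q"] subt_at_ctxt_append[of C "t |_ q" p] by auto
  then show ?thesis using assms(1) unfolding linear_term_def by (metis same_append_eq)
qed


subsection \<open>Orthogonal patterns survive rewriting\<close>

lemma finite_vars_term: "finite (vars_term t)"
  by (induction t) auto

lemma vars_ctxt_apply: "vars_term C\<langle>s\<rangle> = vars_ctxt C \<union> vars_term s"
  by (induction C) auto

lemma vars_subt_at: "q \<in> poss t \<Longrightarrow> vars_term (t |_ q) \<subseteq> vars_term t"
  by (metis ctxt_of_poss vars_ctxt_apply Un_upper2)

lemma subst_map_term: "map_term id \<rho> t \<cdot> \<sigma> = t \<cdot> (\<sigma> \<circ> \<rho>)"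
  by (induction t) auto

lemma ctxt_subst_map_ctxt: "map_ctxt id \<rho> C \<cdot>\<^sub>c \<sigma> = C \<cdot>\<^sub>c (\<sigma> \<circ> \<rho>)"
  by (induction C) (auto simp: subst_map_term[unfolded id_def comp_def] id_def comp_def)

lemma subst_cong: "(\<And>x. x \<in> vars_term t \<Longrightarrow> \<sigma> x = \<tau> x) \<Longrightarrow> t \<cdot> \<sigma> = t \<cdot> \<tau>"
  by (induction t) auto

text \<open>\<open>overlaps_at\<close> asks for a bijective renaming of all variables. The
  involution that swaps \<open>A\<close> with an equally large fresh set \<open>A'\<close> and fixes
  everything else is one; infinitely many variables provide \<open>A'\<close>.\<close>

lemma bij_separating_finite_sets:
  fixes A B :: "'a::infinite set"
  assumes "finite A" "finite B"
  obtains \<rho> where "bij \<rho>" "\<rho> ` A \<inter> B = {}"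
proof -
  have "infinite (- (A \<union> B))" using assms
    by (metis Compl_eq_Diff_UNIV Diff_infinite_finite finite_UnI infinite_UNIV)
  then obtain A' where A': "A' \<subseteq> - (A \<union> B)" "finite A'" "card A' = card A"
    using infinite_arbitrarily_large by blast
  obtain h where h: "bij_betw h A A'"
    using A' assms(1) finite_same_card_bij[of A A'] by metis
  define \<rho> where "\<rho> x = (if x \<in> A then h x else if x \<in> A' then inv_into A h x else x)" for x
  have h1: "h x \<in> A'" "inv_into A h (h x) = x" if "x \<in> A" for x
    using h that by (auto simp: bij_betw_def)
  have h2: "inv_into A h x \<in> A" "h (inv_into A h x) = x" if "x \<in> A'" for x
    using h that by (auto simp: bij_betw_def inv_into_into f_inv_into_f)
  have "\<rho> (\<rho> x) = x" for x
  proof -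
    consider "x \<in> A" "x \<notin> A'" | "x \<in> A'" "x \<notin> A" | "x \<notin> A" "x \<notin> A'"
      using A'(1) by blast
    then show ?thesis
    proof cases
      case 1
      then have "\<rho> x = h x" "h x \<notin> A" using h1(1)[OF 1(1)] A'(1) by (auto simp: \<rho>_def)
      then show ?thesis using h1[OF 1(1)] by (simp add: \<rho>_def)
    next
      case 2
      then show ?thesis using h2[OF 2(1)] by (simp add: \<rho>_def)
    qed (simp add: \<rho>_def)
  qed
  then have "bij \<rho>" by (rule involuntory_imp_bij)
  moreover have "\<rho> ` A \<inter> B = {}" using h1 A'(1) by (auto simp: \<rho>_def)
  ultimately show thesis using that by blast
qed

text \<open>A redex fitting the linear subterm \<open>t |_ q\<close> is an instance of both
  \<open>l\<close> and \<open>t |_ q\<close>. Once \<open>l\<close> is renamed away from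
  \<open>t\<close>, the two substitutions have disjoint domains of interest and merge into the
  single unifier \<open>\<mu>\<close>.\<close>

lemma overlaps_atI:
  fixes t :: "('f, 'v::infinite) term"
  assumes "linear_term t" "q \<in> poss t" "\<nexists>x. t |_ q = Var x" "t |_ q \<sqsubseteq> l \<cdot> \<tau>"
  shows "overlaps_at (l, r) t q"
proof -
  obtain \<tau>' where \<tau>': "l \<cdot> \<tau> = t |_ q \<cdot> \<tau>'"
    using linear_skel_le_instance[OF linear_subt_at[OF assms(1,2)] assms(4)] by blast
  obtain \<rho> where \<rho>: "bij \<rho>" "\<rho> ` vars_term l \<inter> vars_term t = {}"
    using bij_separating_finite_sets finite_vars_term by blast
  define \<mu> where "\<mu> x = (if x \<in> vars_term t then \<tau>' x else \<tau> (inv \<rho> x))" for x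
  have "map_term id \<rho> l \<cdot> \<mu> = l \<cdot> (\<mu> \<circ> \<rho>)" by (rule subst_map_term)
  also have "\<dots> = l \<cdot> \<tau>"
    by (rule subst_cong) (use \<rho> in \<open>auto simp: \<mu>_def bij_is_inj\<close>)
  also have "\<dots> = t |_ q \<cdot> \<mu>"
    unfolding \<tau>' by (rule subst_cong) (use vars_subt_at[OF assms(2)] in \<open>auto simp: \<mu>_def\<close>)
  finally show ?thesis
    using assms(2,3) \<rho> by (auto simp: overlaps_at_def term.set_map)
qed

text \<open>Here \<open>p\<close> is the hole and \<open>o' @ p'\<close> the pattern position of a
  match rooted at \<open>o'\<close>. A step strictly below or parallel to the hole is at no prefix
  of it, hence at no prefix of \<open>o' @ p'\<close>. What remains inside the match is exactly the
  range of positions in the definition of \<open>orth_patterns\<close>.\<close>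

lemma not_above_cases:
  assumes "strict_prefix p q \<or> q \<parallel> p" "prefix (o' @ p') p"
  obtains "q \<parallel> o'" | q' where "q = o' @ q'" "q' \<parallel> p' \<or> strict_prefix p' q'"
proof -
  have p: "\<not> prefix q p"
    using assms(1) by (auto simp: parallel_def strict_prefix_def intro: prefix_order.antisym)
  then have np: "\<not> prefix q (o' @ p')" using assms(2) prefix_order.trans by blast
  then have no: "\<not> prefix q o'" using prefix_prefix by blast
  show thesis
  proof (cases "prefix o' q")
    case True
    then obtain q' where q: "q = o' @ q'" by (auto simp: prefix_def)
    have "\<not> prefix q' p'" using np q by simp
    then show ?thesis using that(2)[OF q] by (auto simp: parallel_def strict_prefix_def)
  next
    case False
    then show ?thesis using that(1) no by auto
  qed
qed

text \<open>No allowedness is recorded: the steps of a chain are going to be repeated with other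
  hole contents, for which nothing is known about it.\<close>

definition side_steps :: "('f, 'v) rule set \<Rightarrow> pos \<Rightarrow> ('f, 'v) term rel" where
  "side_steps R p = {(s, t). \<exists>q. rstep_at R q s t \<and> (strict_prefix p q \<or> q \<parallel> p)}"

definition parallel_steps :: "('f, 'v) rule set \<Rightarrow> pos \<Rightarrow> ('f, 'v) term rel" where
  "parallel_steps R p = {(s, t). \<exists>q. rstep_at R q s t \<and> q \<parallel> p}"

text \<open>A step parallel to the root \<open>o'\<close> leaves the matched subterm alone. A step
  inside it cannot be at a function position of \<open>t\<close>, since the redex would produce an
  overlap there; so \<open>skel_le_ctxt_irrelevant\<close> applies.\<close>

lemma orth_match_step:
  fixes t :: "('f, 'v::infinite) term"
  assumes lin: "linear_term t"
    and orth: "\<not> (\<exists>rl \<in> R. \<exists>q. (q \<parallel> p \<or> strict_prefix p q) \<and> overlaps_at rl t q)"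
    and pre: "prefix (o' @ p) h"
    and step: "(s, u) \<in> side_steps R h"
    and match: "o' \<in> poss s" "t \<sqsubseteq> s |_ o'"
  shows "o' \<in> poss u \<and> t \<sqsubseteq> u |_ o'"
proof -
  from step obtain q l r E \<sigma> where q: "strict_prefix h q \<or> q \<parallel> h" and lr: "(l, r) \<in> R"
    and E: "hole_pos E = q" and s: "s = E\<langle>l \<cdot> \<sigma>\<rangle>" and u: "u = E\<langle>r \<cdot> \<sigma>\<rangle>"
    by (simp add: side_steps_def rstep_at_def) blast
  obtain C where C: "hole_pos C = o'" "s = C\<langle>s |_ o'\<rangle>" using ctxt_of_poss[OF match(1)] .
  have eq: "C\<langle>s |_ o'\<rangle> = E\<langle>l \<cdot> \<sigma>\<rangle>" using C(2) s by simp
  from q pre show ?thesis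
  proof (cases rule: not_above_cases)
    case 1
    then have "hole_pos C \<parallel> hole_pos E" using C E by (auto simp: parallel_def)
    from ctxt_eq_parallel[OF eq this, of "r \<cdot> \<sigma>"] obtain C' where
      "hole_pos C' = hole_pos C" "E\<langle>r \<cdot> \<sigma>\<rangle> = C'\<langle>s |_ o'\<rangle>" by metis
    then show ?thesis
      using match u C hole_pos_in_poss[of C' "s |_ o'"] subt_at_hole_pos[of C' "s |_ o'"] by simp
  next
    case (2 q')
    then have "prefix (hole_pos C) (hole_pos E)" using C E by simp
    from ctxt_eq_below[OF eq this] obtain E' where E': "E = C \<circ>\<^sub>c E'" "s |_ o' = E'\<langle>l \<cdot> \<sigma>\<rangle>" .
    have q': "hole_pos E' = q'" using E' E C 2 by simp
    have "q' \<notin> poss t \<or> (\<exists>x. t |_ q' = Var x)"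
    proof (rule ccontr)
      assume nv: "\<not> ?thesis"
      then have "t |_ q' \<sqsubseteq> l \<cdot> \<sigma>"
        using skel_le_subt_at[OF match(2), of q'] E'(2) q' by auto
      then show False
        using overlaps_atI[OF lin, of q' l \<sigma> r] nv orth lr 2(2) by blast
    qed
    then have "t \<sqsubseteq> E'\<langle>r \<cdot> \<sigma>\<rangle>"
      using skel_le_ctxt_irrelevant[of t E' "l \<cdot> \<sigma>" "r \<cdot> \<sigma>"] match(2) E'(2) q' by simp
    then show ?thesis using u E'(1) C(1) by auto
  qed
qed

lemma orth_match_steps:
  fixes t :: "('f, 'v::infinite) term"
  assumes "(s, u) \<in> (side_steps R h)\<^sup>*" "linear_term t"
    and "\<not> (\<exists>rl \<in> R. \<exists>q. (q \<parallel> p \<or> strict_prefix p q) \<and> overlaps_at rl t q)"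
    and "prefix (o' @ p) h" "o' \<in> poss s" "t \<sqsubseteq> s |_ o'"
  shows "o' \<in> poss u \<and> t \<sqsubseteq> u |_ o'"
  using assms(1,5,6)
proof (induction rule: rtrancl_induct)
  case (step y z)
  then show ?case using orth_match_step[OF assms(2-4)] by blast
qed simp


subsection \<open>Steps below or parallel to a hole\<close>

abbreviation unmark_term :: "('f sym, 'v) term \<Rightarrow> ('f sym, 'v) term" where
  "unmark_term \<equiv> map_term unmark (\<lambda>x. x)"

lemma unmark_ctxt_apply: "unmark_term C\<langle>s\<rangle> = (map_ctxt unmark (\<lambda>x. x) C)\<langle>unmark_term s\<rangle>"
  by (induction C) auto

lemma unmark_subst: "unmark_term (t \<cdot> \<sigma>) = unmark_term t \<cdot> (unmark_term \<circ> \<sigma>)"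
  by (induction t) auto

lemma unmark_base: "funas_term t \<subseteq> base_sig F \<Longrightarrow> unmark_term t = t"
proof (induction t)
  case (Fun f ts)
  have "unmark_term t = t" if "t \<in> set ts" for t
    using Fun that by (simp add: SUP_le_iff)
  moreover have "unmark f = f" using Fun.prems by (auto simp: base_sig_def)
  ultimately show ?case by (simp add: map_idI)
qed simp

text \<open>In contrast to \<open>erase\<close>, removing only the marks keeps all positions, and it
  fixes the rules because they contain no marks.\<close>

lemma rstep_at_unmark:
  assumes "trs (F, R)" "rstep_at R q s t"
  shows "rstep_at R q (unmark_term s) (unmark_term t)"
proof -
  obtain l r C \<sigma> where lr: "(l, r) \<in> R" and C: "hole_pos C = q" "s = C\<langle>l \<cdot> \<sigma>\<rangle>" "t = C\<langle>r \<cdot> \<sigma>\<rangle>"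
    using assms(2) by (auto simp: rstep_at_def)
  have "funas_term l \<subseteq> base_sig F" "funas_term r \<subseteq> base_sig F"
    using assms(1) lr by (auto simp: trs_def)
  then have "unmark_term l = l" "unmark_term r = r" by (auto dest: unmark_base)
  then show ?thesis
    unfolding rstep_at_def
    by (intro exI[of _ l] exI[of _ r] exI[of _ "map_ctxt unmark (\<lambda>x. x) C"] exI[of _ "unmark_term \<circ> \<sigma>"])
      (use lr C in \<open>auto simp: unmark_ctxt_apply unmark_subst\<close>)
qed

lemma rstep_at_ctxt: "rstep_at R q s t \<Longrightarrow> rstep_at R (hole_pos C @ q) C\<langle>s\<rangle> C\<langle>t\<rangle>"
  unfolding rstep_at_def by (metis ctxt_comp_apply hole_pos_comp)

lemma rstep_at_side_cases:
  assumes "rstep_at R q C\<langle>s\<rangle> u" "strict_prefix (hole_pos C) q \<or> q \<parallel> hole_pos C"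
  obtains (below) q' s' where "q = hole_pos C @ q'" "u = C\<langle>s'\<rangle>" "rstep_at R q' s s'"
  | (parallel) C' where "q \<parallel> hole_pos C" "hole_pos C' = hole_pos C" "spine C' = spine C"
    "u = C'\<langle>s\<rangle>" "\<And>X. rstep_at R q C\<langle>X\<rangle> C'\<langle>X\<rangle>"
proof -
  obtain l r E \<sigma> where lr: "(l, r) \<in> R" and E: "hole_pos E = q" "C\<langle>s\<rangle> = E\<langle>l \<cdot> \<sigma>\<rangle>" "u = E\<langle>r \<cdot> \<sigma>\<rangle>"
    using assms(1) by (auto simp: rstep_at_def)
  show thesis
  proof (cases "q \<parallel> hole_pos C")
    case True
    then have "hole_pos C \<parallel> hole_pos E" using E by (auto simp: parallel_def)
    from ctxt_eq_parallel[OF E(2) this, of "r \<cdot> \<sigma>"] obtain C' where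
      C': "hole_pos C' = hole_pos C" "spine C' = spine C" "E\<langle>r \<cdot> \<sigma>\<rangle> = C'\<langle>s\<rangle>"
      and ex: "\<And>X. \<exists>E'. hole_pos E' = hole_pos E \<and> C\<langle>X\<rangle> = E'\<langle>l \<cdot> \<sigma>\<rangle> \<and> C'\<langle>X\<rangle> = E'\<langle>r \<cdot> \<sigma>\<rangle>"
      by blast
    have "rstep_at R q C\<langle>X\<rangle> C'\<langle>X\<rangle>" for X
      using ex[of X] lr E(1) unfolding rstep_at_def by blast
    then show thesis using parallel True C' E(3) by metis
  next
    case False
    then have "prefix (hole_pos C) (hole_pos E)" using assms(2) E(1) by (auto simp: strict_prefix_def)
    from ctxt_eq_below[OF E(2) this] obtain E' where E': "E = C \<circ>\<^sub>c E'" "s = E'\<langle>l \<cdot> \<sigma>\<rangle>" .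
    then have "rstep_at R (hole_pos E') s E'\<langle>r \<cdot> \<sigma>\<rangle>" using lr by (auto simp: rstep_at_def)
    then show thesis using below[of "hole_pos E'" "E'\<langle>r \<cdot> \<sigma>\<rangle>"] E E' by simp
  qed
qed

text \<open>Each step either stays inside the hole or misses it. Forgetting the inner steps leaves a
  reduction of the context that works for every content \<open>X\<close>; keeping them all gives a
  reduction in which the content alone is unmarked.\<close>

lemma side_steps_decompose:
  assumes "trs (F, R)" "(C\<langle>s\<rangle>, u) \<in> (side_steps R (hole_pos C))\<^sup>*"
  shows "\<exists>D s'. u = D\<langle>s'\<rangle> \<and> hole_pos D = hole_pos C \<and> spine D = spine C \<and>
    (\<forall>X. (C\<langle>X\<rangle>, D\<langle>X\<rangle>) \<in> (parallel_steps R (hole_pos C))\<^sup>*) \<and>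
    (C\<langle>unmark_term s\<rangle>, D\<langle>unmark_term s'\<rangle>) \<in> (side_steps R (hole_pos C))\<^sup>*"
  using assms(2)
proof (induction rule: rtrancl_induct)
  case base
  then show ?case by blast
next
  case (step y z)
  then obtain D s' where D: "y = D\<langle>s'\<rangle>" "hole_pos D = hole_pos C" "spine D = spine C"
    and par: "\<And>X. (C\<langle>X\<rangle>, D\<langle>X\<rangle>) \<in> (parallel_steps R (hole_pos C))\<^sup>*"
    and um: "(C\<langle>unmark_term s\<rangle>, D\<langle>unmark_term s'\<rangle>) \<in> (side_steps R (hole_pos C))\<^sup>*"
    by blast
  from step.hyps(2) obtain q where q: "rstep_at R q D\<langle>s'\<rangle> z" "strict_prefix (hole_pos D) q \<or> q \<parallel> hole_pos D"
    by (auto simp: side_steps_def D)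
  from q show ?case
  proof (cases rule: rstep_at_side_cases)
    case (below q' s'')
    have "rstep_at R q D\<langle>unmark_term s'\<rangle> D\<langle>unmark_term s''\<rangle>"
      unfolding below(1) by (intro rstep_at_ctxt rstep_at_unmark[OF assms(1)] below(3))
    then have "(D\<langle>unmark_term s'\<rangle>, D\<langle>unmark_term s''\<rangle>) \<in> side_steps R (hole_pos C)"
      using q(2) D(2) by (auto simp: side_steps_def)
    then show ?thesis using below D par um
      by (intro exI[of _ D] exI[of _ s'']) (auto intro: rtrancl.rtrancl_into_rtrancl)
  next
    case (parallel C')
    have "(D\<langle>X\<rangle>, C'\<langle>X\<rangle>) \<in> parallel_steps R (hole_pos C)" for X
      using parallel D(2) by (auto simp: parallel_steps_def)
    moreover have "(D\<langle>unmark_term s'\<rangle>, C'\<langle>unmark_term s'\<rangle>) \<in> side_steps R (hole_pos C)"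
      using parallel D(2) by (auto simp: side_steps_def)
    ultimately show ?thesis using parallel D par um
      by (intro exI[of _ C'] exI[of _ s']) (auto intro: rtrancl.rtrancl_into_rtrancl)
  qed
qed

text \<open>The hole position determines context and content, so the decomposition found abstractly
  is the one named by the chain.\<close>

lemma side_steps_same_hole:
  assumes "trs (F, R)" "(C\<langle>s\<rangle>, D\<langle>s'\<rangle>) \<in> (side_steps R (hole_pos C))\<^sup>*" "hole_pos D = hole_pos C"
  shows "spine D = spine C" "(C\<langle>X\<rangle>, D\<langle>X\<rangle>) \<in> (parallel_steps R (hole_pos C))\<^sup>*"
    "(C\<langle>unmark_term s\<rangle>, D\<langle>unmark_term s'\<rangle>) \<in> (side_steps R (hole_pos C))\<^sup>*"
proof -
  obtain D' s'' where D': "D\<langle>s'\<rangle> = D'\<langle>s''\<rangle>" "hole_pos D' = hole_pos C" "spine D' = spine C"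
    "\<And>X. (C\<langle>X\<rangle>, D'\<langle>X\<rangle>) \<in> (parallel_steps R (hole_pos C))\<^sup>*"
    "(C\<langle>unmark_term s\<rangle>, D'\<langle>unmark_term s''\<rangle>) \<in> (side_steps R (hole_pos C))\<^sup>*"
    using side_steps_decompose[OF assms(1,2)] by blast
  then have "D = D' \<and> s' = s''" using ctxt_eq_same_pos[OF D'(1)] assms(3) by simp
  then show "spine D = spine C" "(C\<langle>X\<rangle>, D\<langle>X\<rangle>) \<in> (parallel_steps R (hole_pos C))\<^sup>*"
    "(C\<langle>unmark_term s\<rangle>, D\<langle>unmark_term s'\<rangle>) \<in> (side_steps R (hole_pos C))\<^sup>*"
    using D' by auto
qed

lemma chain_rsteps_side: "(chain_rsteps R \<Pi> T p)\<^sup>* \<subseteq> (side_steps R p)\<^sup>*"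
  by (rule rtrancl_mono) (auto simp: chain_rsteps_def side_steps_def)

lemma parallel_steps_side: "(parallel_steps R p)\<^sup>* \<subseteq> (side_steps R p)\<^sup>*"
  by (rule rtrancl_mono) (auto simp: parallel_steps_def side_steps_def)

lemma parallel_steps_append: "(parallel_steps R p)\<^sup>* \<subseteq> (parallel_steps R (p @ q))\<^sup>*"
  by (rule rtrancl_mono) (auto simp: parallel_steps_def intro: parallel_append parallel_commute
      dest: append_prefixD prefix_prefix simp: parallel_def prefix_append)


subsection \<open>Erasing\<close>

lemma erase_skel_le_subst: "erase T t \<sqsubseteq> erase T (t \<cdot> \<sigma>)"
proof (induction t)
  case (Fun g ts)
  show ?case
  proof (cases "g = Sym T \<and> length ts = 1")
    case True
    then obtain t where "ts = [t]" by (cases ts) auto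
    then show ?thesis using Fun True by simp
  next
    case False
    then have "erase T (Fun g ts) = Fun (unmark g) (map (erase T) ts)"
      "erase T (Fun g ts \<cdot> \<sigma>) = Fun (unmark g) (map (\<lambda>t. erase T (t \<cdot> \<sigma>)) ts)"
      by (auto simp: o_def)
    then show ?thesis using Fun by (auto intro!: skel_le.Fun)
  qed
qed simp

lemma erase_eq_unmark:
  assumes "only_at_root T t" "\<not> root_is T t"
  shows "erase T t = unmark_term t"
proof -
  have "\<not> root_is T (t |_ q)" if "q \<in> poss t" for q
    using that assms by (cases q) (simp_all add: only_at_root_def)
  then show ?thesis
  proof (induction t)
    case (Fun g ts)
    have g: "g \<noteq> Sym T" using Fun.prems[of "[]"] by (simp add: root_is_def)
    have "erase T u = unmark_term u" if u: "u \<in> set ts" for u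
    proof (rule Fun.IH[OF u])
      fix q
      assume q: "q \<in> poss u"
      obtain i where i: "i < length ts" "u = ts ! i" using u unfolding in_set_conv_nth by blast
      have "i # q \<in> poss (Fun g ts)" using q i by (auto simp: image_iff)
      from Fun.prems[OF this] show "\<not> root_is T (u |_ q)" using i by simp
    qed
    then show ?case using g by simp
  qed simp
qed

lemma erase_ctxt_spine:
  assumes "Sym T \<notin> set (spine C)"
  shows "hole_pos C \<in> poss (erase T C\<langle>s\<rangle>) \<and> erase T C\<langle>s\<rangle> |_ hole_pos C = erase T s"
  using assms by (induction C) (auto simp: nth_append)

text \<open>At the function positions of \<open>t\<close> the term \<open>s\<close> cannot carry
  \<open>T\<close>, since \<open>T\<close> is foreign to the signature of \<open>t\<close>; down to
  there erasing merely removes marks.\<close>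

lemma skel_le_erase_of_unmark:
  assumes "t \<sqsubseteq> unmark_term s" "funas_term t \<subseteq> base_sig F" "T \<notin> fst ` F"
  shows "t \<sqsubseteq> erase T s"
  using assms(1,2)
proof (induction t arbitrary: s)
  case (Fun f ts)
  then obtain g ss where s: "s = Fun g ss" by (cases s) (auto simp: skel_le_Fun_iff)
  then have f: "f = unmark g" and len: "length ts = length ss"
    and sub: "\<And>i. i < length ts \<Longrightarrow> ts ! i \<sqsubseteq> unmark_term (ss ! i)"
    using Fun.prems(1) by (auto simp: skel_le_Fun_Fun_iff)
  have "f \<noteq> Sym T" using Fun.prems(2) assms(3) by (force simp: base_sig_def)
  then have "g \<noteq> Sym T" using f by auto
  moreover have "ts ! i \<sqsubseteq> erase T (ss ! i)" if "i < length ts" for i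
    using Fun.IH[of "ts ! i" "ss ! i"] that sub Fun.prems(2) by (fastforce simp: in_set_conv_nth)
  ultimately show ?case using s f len by (auto intro!: skel_le.Fun)
qed simp

lemma skel_le_erase_self:
  assumes "t \<sqsubseteq> s" "funas_term t \<subseteq> base_sig F" "T \<notin> fst ` F"
  shows "t \<sqsubseteq> erase T s"
proof (rule skel_le_erase_of_unmark[OF _ assms(2,3)])
  have "unmark_term t \<sqsubseteq> unmark_term s" by (rule skel_le_map[OF assms(1)])
  then show "t \<sqsubseteq> unmark_term s" using unmark_base[OF assms(2)] by simp
qed

text \<open>Glues the two kinds of content together: the context is still unerased, while
  \<open>Y\<close> is an erased or unmarked version of \<open>s\<close>. Wherever \<open>t\<close>
  has a function symbol, the context shows a plain symbol other than \<open>T\<close>, which erasing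
  keeps.\<close>

lemma skel_le_erase_ctxt:
  assumes "t \<sqsubseteq> C\<langle>Y\<rangle>" "funas_term t \<subseteq> base_sig F" "T \<notin> fst ` F"
    and Y: "\<And>t :: ('f sym, 'v) term. t \<sqsubseteq> Y \<Longrightarrow> funas_term t \<subseteq> base_sig F \<Longrightarrow> t \<sqsubseteq> erase T s"
  shows "(t :: ('f sym, 'v) term) \<sqsubseteq> erase T C\<langle>s\<rangle>"
  using assms(1,2)
proof (induction C arbitrary: t)
  case Hole
  then show ?case using Y by simp
next
  case (More f ss C ts)
  show ?case
  proof (cases t)
    case (Var x)
    then show ?thesis by simp
  next
    case (Fun g us)
    have len: "length us = Suc (length ss + length ts)" and g: "g = f"
      and us: "\<And>i. i < length us \<Longrightarrow> us ! i \<sqsubseteq> (ss @ C\<langle>Y\<rangle> # ts) ! i"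
      using More.prems(1) Fun by (auto simp: skel_le_Fun_Fun_iff)
    have base: "funas_term (us ! i) \<subseteq> base_sig F" if "i < length us" for i
      using More.prems(2) Fun that by (auto simp: SUP_le_iff)
    have f: "f \<noteq> Sym T" "unmark f = f"
      using More.prems(2) Fun g assms(3) by (force simp: base_sig_def)+
    have "us ! i \<sqsubseteq> erase T ((ss @ C\<langle>s\<rangle> # ts) ! i)" if "i < length us" for i
    proof (cases "i = length ss")
      case True
      then show ?thesis using More.IH[of "us ! i"] us[OF that] base[OF that] by simp
    next
      case False
      then have "(ss @ C\<langle>s\<rangle> # ts) ! i = (ss @ C\<langle>Y\<rangle> # ts) ! i" by (auto simp: nth_append nth_Cons')
      then show ?thesis using skel_le_erase_self[OF us[OF that] base[OF that] assms(3)] by simp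
    qed
    moreover have "erase T (More f ss C ts)\<langle>s\<rangle> = Fun f (map (erase T) (ss @ C\<langle>s\<rangle> # ts))"
      using f by simp
    ultimately show ?thesis using Fun g len by (auto intro!: skel_le.Fun simp del: map_append)
  qed
qed


subsection \<open>The simple context processor\<close>

lemma cdp_variant_subst:
  assumes "cdp_variant \<beta> \<alpha>"
  obtains \<theta> where "cdp_rhs \<alpha> \<cdot> \<sigma> = cdp_rhs \<beta> \<cdot> \<theta>" "cdp_ctxt \<alpha> \<cdot>\<^sub>c \<sigma> = cdp_ctxt \<beta> \<cdot>\<^sub>c \<theta>"
    "root_is T (cdp_rhs \<alpha>) \<longleftrightarrow> root_is T (cdp_rhs \<beta>)"
    "funs_ctxt (cdp_ctxt \<alpha>) = funs_ctxt (cdp_ctxt \<beta>)"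
proof -
  obtain \<rho> where
    "\<alpha> = (map_term id \<rho> (cdp_lhs \<beta>), map_term id \<rho> (cdp_rhs \<beta>), map_ctxt id \<rho> (cdp_ctxt \<beta>))"
    using assms unfolding cdp_variant_def by blast
  then have \<rho>: "cdp_rhs \<alpha> = map_term id \<rho> (cdp_rhs \<beta>)" "cdp_ctxt \<alpha> = map_ctxt id \<rho> (cdp_ctxt \<beta>)"
    by (simp_all only: fst_conv snd_conv)
  have root: "root_is T (map_term id \<rho> t) \<longleftrightarrow> root_is T t" for t
    by (cases t) (auto simp: root_is_def)
  have funs: "funs_ctxt (map_ctxt id \<rho> C) = funs_ctxt C" for C
    by (simp only: ctxt.set_map image_id id_apply)
  show thesis
    by (rule that[of "\<sigma> \<circ> \<rho>"]) (simp_all only: \<rho> subst_map_term ctxt_subst_map_ctxt root funs)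
qed

lemma compose_ctxts_simps [simp]:
  "compose_ctxts [] = Hole" "compose_ctxts (\<alpha> # \<alpha>s) = cdp_ctxt \<alpha> \<circ>\<^sub>c compose_ctxts \<alpha>s"
  by (auto simp: compose_ctxts_def)

lemma compose_ctxts_append: "compose_ctxts (\<alpha>s @ \<beta>s) = compose_ctxts \<alpha>s \<circ>\<^sub>c compose_ctxts \<beta>s"
  by (induction \<alpha>s) (auto simp: ctxt_comp_assoc)

lemma ctxt_subst_comp: "(C \<circ>\<^sub>c D) \<cdot>\<^sub>c \<sigma> = (C \<cdot>\<^sub>c \<sigma>) \<circ>\<^sub>c (D \<cdot>\<^sub>c \<sigma>)"
  by (induction C) auto

text \<open>Each variant is an instance of its original by a substitution of its own. These need not
  agree on variables shared between the originals, which is why the conclusion is stated with the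
  skeleton order.\<close>

lemma compose_variants:
  assumes "list_all2 cdp_variant \<beta>s \<alpha>s" "s \<sqsubseteq> t"
  shows "hole_pos (compose_ctxts \<beta>s) = hole_pos (compose_ctxts \<alpha>s)"
    and "(compose_ctxts \<beta>s)\<langle>s\<rangle> \<sqsubseteq> (compose_ctxts \<alpha>s \<cdot>\<^sub>c \<sigma>)\<langle>t\<rangle>"
proof -
  have "hole_pos (compose_ctxts \<beta>s) = hole_pos (compose_ctxts \<alpha>s) \<and>
    (compose_ctxts \<beta>s)\<langle>s\<rangle> \<sqsubseteq> (compose_ctxts \<alpha>s \<cdot>\<^sub>c \<sigma>)\<langle>t\<rangle>"
    using assms(1)
  proof (induction rule: list_all2_induct)
    case Nil
    then show ?case using assms(2) by simp
  next
    case (Cons \<beta> \<beta>s \<alpha> \<alpha>s)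
    obtain \<theta> where \<theta>: "cdp_ctxt \<alpha> \<cdot>\<^sub>c \<sigma> = cdp_ctxt \<beta> \<cdot>\<^sub>c \<theta>"
      using cdp_variant_subst[OF Cons.hyps(1)] by metis
    then have "hole_pos (cdp_ctxt \<alpha>) = hole_pos (cdp_ctxt \<beta>)" by (metis hole_pos_subst)
    then show ?case using Cons.IH \<theta> by (simp add: ctxt_subst_comp skel_le_ctxt_subst)
  qed
  then show "hole_pos (compose_ctxts \<beta>s) = hole_pos (compose_ctxts \<alpha>s)"
    "(compose_ctxts \<beta>s)\<langle>s\<rangle> \<sqsubseteq> (compose_ctxts \<alpha>s \<cdot>\<^sub>c \<sigma>)\<langle>t\<rangle>" by auto
qed

text \<open>Whatever the R-steps do inside the hole is overwritten when the next CDP is applied.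
  Hence the contexts evolve by parallel steps alone, and all of the next \<open>k\<close> CDP
  contexts can be put in place before any of these steps.\<close>

lemma chain_contexts:
  assumes "trs (F, R)"
    and noT: "\<And>i. Sym T \<notin> funs_ctxt (cdp_ctxt (\<alpha> i))"
    and hole: "\<And>i. hole_pos (D (Suc i)) = hole_pos (D i \<circ>\<^sub>c (cdp_ctxt (\<alpha> i) \<cdot>\<^sub>c \<sigma>))"
    and steps: "\<And>i. ((D i \<circ>\<^sub>c (cdp_ctxt (\<alpha> i) \<cdot>\<^sub>c \<sigma>))\<langle>cdp_rhs (\<alpha> i) \<cdot> \<sigma>\<rangle>,
        (D (Suc i))\<langle>cdp_lhs (\<alpha> (Suc i)) \<cdot> \<sigma>\<rangle>)
        \<in> (side_steps R (hole_pos (D i \<circ>\<^sub>c (cdp_ctxt (\<alpha> i) \<cdot>\<^sub>c \<sigma>))))\<^sup>*"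
  shows "D 0 = Hole \<Longrightarrow> Sym T \<notin> set (spine (D i))"
    and "hole_pos (D (i + k)) = hole_pos (D i) @ hole_pos (compose_ctxts (map \<alpha> [i..<i + k]))"
    and "((D i)\<langle>(compose_ctxts (map \<alpha> [i..<i + k]) \<cdot>\<^sub>c \<sigma>)\<langle>X\<rangle>\<rangle>, (D (i + k))\<langle>X\<rangle>)
        \<in> (parallel_steps R (hole_pos (D (i + k))))\<^sup>*"
proof -
  show "Sym T \<notin> set (spine (D i))" if "D 0 = Hole"
  proof (induction i)
    case 0
    then show ?case using that by simp
  next
    case (Suc i)
    then show ?case
      using side_steps_same_hole(1)[OF assms(1) steps hole] noT[of i] set_spine[of "cdp_ctxt (\<alpha> i)"]
      by auto
  qed
  show *: "hole_pos (D (i + k)) = hole_pos (D i) @ hole_pos (compose_ctxts (map \<alpha> [i..<i + k]))" for k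
    by (induction k) (auto simp: hole compose_ctxts_append)
  show "((D i)\<langle>(compose_ctxts (map \<alpha> [i..<i + k]) \<cdot>\<^sub>c \<sigma>)\<langle>X\<rangle>\<rangle>, (D (i + k))\<langle>X\<rangle>)
        \<in> (parallel_steps R (hole_pos (D (i + k))))\<^sup>*"
  proof (induction k arbitrary: X)
    case 0
    then show ?case by simp
  next
    case (Suc k)
    let ?c = "cdp_ctxt (\<alpha> (i + k)) \<cdot>\<^sub>c \<sigma>"
    have h: "hole_pos (D (i + Suc k)) = hole_pos (D (i + k)) @ hole_pos ?c" using hole[of "i + k"] by simp
    \<comment> \<open>The induction hypothesis is used with the next context already in the hole; a
      step parallel to the old hole is also parallel to the deeper new one.\<close>
    have "((D i)\<langle>(compose_ctxts (map \<alpha> [i..<i + k]) \<cdot>\<^sub>c \<sigma>)\<langle>?c\<langle>X\<rangle>\<rangle>\<rangle>, (D (i + k))\<langle>?c\<langle>X\<rangle>\<rangle>)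
        \<in> (parallel_steps R (hole_pos (D (i + Suc k))))\<^sup>*"
      using Suc.IH[of "?c\<langle>X\<rangle>"] parallel_steps_append unfolding h by blast
    moreover have "((D (i + k))\<langle>?c\<langle>X\<rangle>\<rangle>, (D (i + Suc k))\<langle>X\<rangle>)
        \<in> (parallel_steps R (hole_pos (D (i + Suc k))))\<^sup>*"
      using side_steps_same_hole(2)[OF assms(1) steps hole, of "i + k" X] hole[of "i + k"] by simp
    ultimately show ?case by (simp add: compose_ctxts_append ctxt_subst_comp)
  qed
qed

lemma removed_cdp_not_in_chain:
  fixes P :: "('f, 'v::infinite) cdp set"
  assumes prob: "cdp_problem (P, (F, R), \<Pi>, T)"
    and app: "scp_applicable n \<gamma> (P, (F, R), \<Pi>, T)"
    and "n > 0" "\<gamma> \<in> P"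
    and chain: "cdp_chain_with (P, (F, R), \<Pi>, T) \<alpha> \<sigma> D"
  shows "\<not> cdp_variant \<gamma> (\<alpha> i)"
proof
  assume \<gamma>: "cdp_variant \<gamma> (\<alpha> i)"
  let ?C = "\<lambda>j. D j \<circ>\<^sub>c (cdp_ctxt (\<alpha> j) \<cdot>\<^sub>c \<sigma>)"
  have trs: "trs (F, R)" and T: "T \<notin> fst ` F"
    and \<Pi>: "\<forall>(t, p, k) \<in> \<Pi>. funas_term t \<subseteq> base_sig F \<and> p \<in> poss t"
    and P: "\<forall>(u, v, c) \<in> P. funas_term u \<subseteq> ext_sig F T \<and> funas_term v \<subseteq> ext_sig F T \<and>
      funas_ctxt c \<subseteq> ext_sig F T \<and> only_at_root T u \<and> only_at_root T v \<and> Sym T \<notin> funs_ctxt c"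
    using prob unfolding cdp_problem.simps by blast+
  have P_root: "only_at_root T (cdp_rhs \<beta>)" and P_ctxt: "Sym T \<notin> funs_ctxt (cdp_ctxt \<beta>)"
    if "\<beta> \<in> P" for \<beta>
    using bspec[OF P that] by (simp_all add: case_prod_beta)
  note chain = chain[unfolded cdp_chain_with.simps Let_def]
  note chain_step = chain[THEN conjunct2, THEN conjunct2, THEN conjunct2, THEN conjunct2, THEN spec]
  \<comment> \<open>\<open>\<alpha> i\<close> may be a variant of several members of
    \<open>P\<close>, but applicability speaks only of sequences headed by \<open>\<gamma>\<close>
    itself, so the original at index \<open>i\<close> is fixed.\<close>
  have "\<exists>\<beta>. \<beta> \<in> P \<and> cdp_variant \<beta> (\<alpha> j) \<and> (j = i \<longrightarrow> \<beta> = \<gamma>)" for j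
  proof (cases "j = i")
    case False
    then show ?thesis using chain[THEN conjunct1, THEN spec, of j] by blast
  qed (use \<gamma> \<open>\<gamma> \<in> P\<close> in blast)
  then obtain \<beta> where \<beta>: "\<And>j. \<beta> j \<in> P" "\<And>j. cdp_variant (\<beta> j) (\<alpha> j)" "\<beta> i = \<gamma>" by metis
  have D0: "D 0 = Hole" using chain by (elim conjE)
  have allowed: "hole_pos (D j) \<in> allowed \<Pi> (erase T (D j)\<langle>cdp_lhs (\<alpha> j) \<cdot> \<sigma>\<rangle>)" for j
    by (rule chain_step[THEN conjunct1])
  have hole: "hole_pos (D (Suc j)) = hole_pos (?C j)" for j
    by (rule chain_step[THEN conjunct2, THEN conjunct1])
  have steps: "((?C j)\<langle>cdp_rhs (\<alpha> j) \<cdot> \<sigma>\<rangle>, (D (Suc j))\<langle>cdp_lhs (\<alpha> (Suc j)) \<cdot> \<sigma>\<rangle>)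
      \<in> (side_steps R (hole_pos (?C j)))\<^sup>*" for j
    by (rule subsetD[OF chain_rsteps_side chain_step[THEN conjunct2, THEN conjunct2, THEN conjunct1]])
  have Troot: "(?C j)\<langle>cdp_rhs (\<alpha> j) \<cdot> \<sigma>\<rangle> = (D (Suc j))\<langle>cdp_lhs (\<alpha> (Suc j)) \<cdot> \<sigma>\<rangle>"
    if "root_is T (cdp_rhs (\<alpha> j))" for j
    by (rule chain_step[THEN conjunct2, THEN conjunct2, THEN conjunct2, THEN mp, OF that])
  have noT: "Sym T \<notin> funs_ctxt (cdp_ctxt (\<alpha> j))" for j
    using cdp_variant_subst[OF \<beta>(2)[of j]] P_ctxt[OF \<beta>(1)[of j]] by metis
  note contexts = chain_contexts[where \<alpha> = \<alpha> and D = D and \<sigma> = \<sigma> and T = T, OF trs noT hole steps]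

  \<comment> \<open>The window is \<open>\<alpha> i\<close> to \<open>\<alpha> (i + m)\<close>; the
    step to be refuted is the following one, that of \<open>\<alpha> (i + n)\<close>.\<close>
  obtain m where n: "n = Suc m" using \<open>n > 0\<close> by (cases n) auto
  let ?s = "cdp_rhs (\<alpha> (i + m)) \<cdot> \<sigma>" and ?s' = "cdp_lhs (\<alpha> (i + n)) \<cdot> \<sigma>"
  let ?\<beta>s = "map \<beta> [i..<i + n]" and ?\<alpha>s = "map \<alpha> [i..<i + n]"
  let ?K = "compose_ctxts ?\<alpha>s \<cdot>\<^sub>c \<sigma>"
  have "hd ?\<beta>s = \<gamma>" using \<beta>(3) n by (simp add: upt_conv_Cons del: upt_Suc)
  then have "hole_pos (compose_ctxts ?\<beta>s) \<in> forbidden (orth_patterns R \<Pi>)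
      (compose_ctxts ?\<beta>s)\<langle>erase T (cdp_rhs (last ?\<beta>s))\<rangle>"
    using app \<beta>(1) by (auto simp: image_subset_iff)
  moreover have "last ?\<beta>s = \<beta> (i + m)" using n by simp
  ultimately obtain t p k where tpk: "(t, p, k) \<in> orth_patterns R \<Pi>"
    and forb: "hole_pos (compose_ctxts ?\<beta>s)
      \<in> pattern_poss (t, p, k) (compose_ctxts ?\<beta>s)\<langle>erase T (cdp_rhs (\<beta> (i + m)))\<rangle>"
    by (auto simp: forbidden_def)
  let ?M = "(compose_ctxts ?\<beta>s)\<langle>erase T (cdp_rhs (\<beta> (i + m)))\<rangle>"
  have pat: "(t, p, k) \<in> \<Pi>" and k: "k = Here \<or> k = Below" and lin: "linear_term t"
    and orth: "\<not> (\<exists>rl \<in> R. \<exists>q. (q \<parallel> p \<or> strict_prefix p q) \<and> overlaps_at rl t q)"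
    using tpk by (auto simp: orth_patterns_def)
  have base: "funas_term t \<subseteq> base_sig F" using bspec[OF \<Pi> pat] by simp
  obtain o' \<tau> where o': "o' \<in> poss ?M" "?M |_ o' = t \<cdot> \<tau>"
    and rel: "k = Here \<and> o' @ p = hole_pos (compose_ctxts ?\<beta>s) \<or>
      k = Below \<and> strict_prefix (o' @ p) (hole_pos (compose_ctxts ?\<beta>s))"
    using forb k by (auto simp: match_poss_def)
  have variants: "list_all2 cdp_variant ?\<beta>s ?\<alpha>s"
    using \<beta>(2) by (simp add: list_all2_conv_all_nth)
  have holeK: "hole_pos ?K = hole_pos (compose_ctxts ?\<beta>s)"
    using compose_variants(1)[OF variants skel_le_refl] by simp
  let ?r = "hole_pos (D i) @ o'" and ?h = "hole_pos (D (i + n))"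
  have h: "?h = hole_pos (D i) @ hole_pos ?K" using contexts(2)[of i n] by simp
  have hC: "hole_pos (?C (i + m)) = ?h" using hole[of "i + m"] n by simp
  \<comment> \<open>With the flags \<open>Here\<close> and \<open>Below\<close> the pattern position
    is at or above the hole; the flag \<open>Above\<close> would not give this.\<close>
  have pre: "prefix (?r @ p) ?h"
    using rel unfolding h holeK by (auto simp: strict_prefix_def)
  have "prefix ?r ?h" using pre by (meson append_prefixD)

  obtain \<theta> where \<theta>: "?s = cdp_rhs (\<beta> (i + m)) \<cdot> \<theta>"
    and root: "root_is T (cdp_rhs (\<alpha> (i + m))) \<longleftrightarrow> root_is T (cdp_rhs (\<beta> (i + m)))"
    using cdp_variant_subst[OF \<beta>(2)[of "i + m"]] by metis

  text \<open>Up to the last CDP step only the steps parallel to the hole matter, and these can be replayed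
    with the instantiated remaining contexts in the hole; so the match is tracked from the start.\<close>
  have matched: "?r \<in> poss (?C (i + m))\<langle>X\<rangle> \<and> t \<sqsubseteq> (?C (i + m))\<langle>X\<rangle> |_ ?r"
    if X: "erase T (cdp_rhs (\<beta> (i + m))) \<sqsubseteq> X" for X
  proof -
    have "?M \<sqsubseteq> ?K\<langle>X\<rangle>" by (rule compose_variants(2)[OF variants X])
    then have "o' \<in> poss ?K\<langle>X\<rangle>" and *: "?M |_ o' \<sqsubseteq> ?K\<langle>X\<rangle> |_ o'"
      using skel_le_subt_at o'(1) by blast+
    moreover have "t \<sqsubseteq> ?K\<langle>X\<rangle> |_ o'"
      using skel_le_trans[OF skel_le_subst *[unfolded o'(2)]] .
    ultimately have start: "?r \<in> poss (D i)\<langle>?K\<langle>X\<rangle>\<rangle>" "t \<sqsubseteq> (D i)\<langle>?K\<langle>X\<rangle>\<rangle> |_ ?r"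
      by (auto simp: poss_ctxt_append)
    let ?c = "cdp_ctxt (\<alpha> (i + m)) \<cdot>\<^sub>c \<sigma>"
    \<comment> \<open>The replay ends right after the CDP step of \<open>\<alpha> (i + m)\<close>.
      The R-steps following it may rewrite inside \<open>?s\<close>, so they cannot be repeated for
      arbitrary \<open>X\<close>.\<close>
    have "((D i)\<langle>(compose_ctxts (map \<alpha> [i..<i + m]) \<cdot>\<^sub>c \<sigma>)\<langle>?c\<langle>X\<rangle>\<rangle>\<rangle>, (D (i + m))\<langle>?c\<langle>X\<rangle>\<rangle>)
        \<in> (side_steps R ?h)\<^sup>*"
      using contexts(3)[of i m "?c\<langle>X\<rangle>"] parallel_steps_append[of R "hole_pos (D (i + m))" "hole_pos ?c"]
        parallel_steps_side[of R ?h] hC by auto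
    then have "((D i)\<langle>?K\<langle>X\<rangle>\<rangle>, (?C (i + m))\<langle>X\<rangle>) \<in> (side_steps R ?h)\<^sup>*"
      using n by (simp add: compose_ctxts_append ctxt_subst_comp)
    then show ?thesis by (rule orth_match_steps[OF _ lin orth pre start])
  qed

  text \<open>If the root of the last right-hand side is not \<open>T\<close>, that side contains no \<open>T\<close> at all, so that
    erasing only removes marks and does not shift the positions of the final \<open>R\<close>-steps.\<close>
  have "\<exists>Y. ?r \<in> poss (D (i + n))\<langle>Y\<rangle> \<and> t \<sqsubseteq> (D (i + n))\<langle>Y\<rangle> |_ ?r \<and>
    (Y = erase T ?s' \<or> Y = unmark_term ?s')"
  proof (cases "root_is T (cdp_rhs (\<alpha> (i + m)))")
    case True
    have "(?C (i + m))\<langle>?s\<rangle> = (D (i + n))\<langle>?s'\<rangle>" using Troot[OF True] n by simp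
    then have "?C (i + m) = D (i + n) \<and> ?s = ?s'" using ctxt_eq_same_pos hC by blast
    then show ?thesis using matched[of "erase T ?s"] erase_skel_le_subst[of T _ \<theta>] \<theta> by metis
  next
    case False
    have "only_at_root T (cdp_rhs (\<beta> (i + m)))" by (rule P_root[OF \<beta>(1)])
    then have "erase T (cdp_rhs (\<beta> (i + m))) \<sqsubseteq> unmark_term ?s"
      using erase_eq_unmark False root \<theta> skel_le_map[OF skel_le_subst] by metis
    note start = matched[OF this]
    have "((?C (i + m))\<langle>unmark_term ?s\<rangle>, (D (i + n))\<langle>unmark_term ?s'\<rangle>) \<in> (side_steps R ?h)\<^sup>*"
      using side_steps_same_hole(3)[OF trs steps hole, of "i + m"] hC n by simp
    then show ?thesis
      using orth_match_steps[OF _ lin orth pre] start by blast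
  qed
  then obtain Y where Y: "t \<sqsubseteq> (D (i + n))\<langle>Y\<rangle> |_ ?r" "Y = erase T ?s' \<or> Y = unmark_term ?s'"
    by blast

  \<comment> \<open>Splitting at the root of the match separates two concerns: \<open>C1\<close> has
    no \<open>T\<close> on its path, so erasing keeps the position \<open>?r\<close>, and below it
    the match is carried over to the erased term.\<close>
  obtain C1 C2 where C2: "D (i + n) = C1 \<circ>\<^sub>c C2" and C1: "hole_pos C1 = ?r"
    using ctxt_split \<open>prefix ?r ?h\<close> by metis
  have "t \<sqsubseteq> C2\<langle>Y\<rangle>" using Y(1) C1 unfolding C2 by (metis ctxt_comp_apply subt_at_hole_pos)
  then have "t \<sqsubseteq> erase T C2\<langle>?s'\<rangle>"
    using skel_le_erase_ctxt[OF _ base T] skel_le_erase_of_unmark[OF _ _ T] Y(2) by metis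
  then obtain \<mu> where \<mu>: "erase T C2\<langle>?s'\<rangle> = t \<cdot> \<mu>" using linear_skel_le_instance[OF lin] by blast
  let ?u = "erase T (D (i + n))\<langle>?s'\<rangle>"
  have "Sym T \<notin> set (spine C1)" using contexts(1)[OF D0, of "i + n"] C2 by simp
  then have "?r \<in> poss ?u" "?u |_ ?r = t \<cdot> \<mu>"
    using erase_ctxt_spine[of T C1 "C2\<langle>?s'\<rangle>"] C1 \<mu> unfolding C2 by auto
  then have "?r @ p \<in> match_poss t p ?u" unfolding match_poss_def by blast
  moreover have "k = Here \<and> ?h = ?r @ p \<or> k = Below \<and> strict_prefix (?r @ p) ?h"
    using rel unfolding h holeK by (auto simp: strict_prefix_def)
  ultimately have "?h \<in> pattern_poss (t, p, k) ?u" by auto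
  then show False using allowed[of "i + n"] pat by (auto simp: allowed_def forbidden_def)
qed

text \<open>The set of CDPs restricts a chain only by requiring originals for its members, so the
  same \<open>\<sigma>\<close> and \<open>D\<close> serve. Soundness uses this to shrink the set,
  completeness to enlarge it.\<close>

lemma infinite_minimal_chain_change_cdps:
  assumes "cdp_chain_with (P, (F, R), \<Pi>, T) \<alpha> \<sigma> D" "minimal_with (P, (F, R), \<Pi>, T) \<alpha> \<sigma> D"
    and "\<forall>i. \<exists>\<beta> \<in> Q. cdp_variant \<beta> (\<alpha> i)"
  shows "infinite_minimal_chain (Q, (F, R), \<Pi>, T) \<alpha>"
proof -
  have "cdp_chain_with (Q, (F, R), \<Pi>, T) \<alpha> \<sigma> D"
    using assms(1,3) unfolding cdp_chain_with.simps by (elim conjE, intro conjI)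
  moreover have "minimal_with (Q, (F, R), \<Pi>, T) \<alpha> \<sigma> D"
    using assms(2) unfolding minimal_with.simps .
  ultimately show ?thesis unfolding infinite_minimal_chain_def by blast
qed

theorem theorem2:
  fixes n :: nat
    and sel :: "('f, 'v::infinite) cdp_problem \<Rightarrow> ('f, 'v) cdp"
  assumes "n > 1"
  shows "cdp_processor (SCP n sel) \<and> sound_processor (SCP n sel) \<and> complete_processor (SCP n sel)"
proof (intro conjI)
  show "cdp_processor (SCP n sel)"
    unfolding cdp_processor_def
  proof (intro allI impI ballI)
    fix X Y :: "('f, 'v) cdp_problem"
    assume X: "cdp_problem X" and Y: "Y \<in> SCP n sel X"
    obtain P F R \<Pi> T where XP: "X = (P, (F, R), \<Pi>, T)" by (cases X) auto
    have "Y = X \<or> Y = (P - {sel X}, (F, R), \<Pi>, T)"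
      using Y unfolding XP by (simp add: Let_def del: scp_applicable.simps split: if_splits)
    moreover have "cdp_problem (P - {sel X}, (F, R), \<Pi>, T)"
      using X unfolding XP cdp_problem.simps by blast
    ultimately show "cdp_problem Y" using X by blast
  qed
  show "sound_processor (SCP n sel)"
    unfolding sound_processor_def
  proof (intro allI impI)
    fix X :: "('f, 'v) cdp_problem"
    assume X: "cdp_problem X" and fin: "\<forall>Y \<in> SCP n sel X. finite_problem Y"
    obtain P F R \<Pi> T where XP: "X = (P, (F, R), \<Pi>, T)" by (cases X) auto
    show "finite_problem X"
    proof (cases "sel X \<in> P \<and> scp_applicable n (sel X) X")
      case True
      show ?thesis
        unfolding finite_problem_def
      proof
        assume "\<exists>\<alpha>. infinite_minimal_chain X \<alpha>"
        then obtain \<alpha> \<sigma> D where chain: "cdp_chain_with X \<alpha> \<sigma> D" "minimal_with X \<alpha> \<sigma> D"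
          unfolding infinite_minimal_chain_def by blast
        have "\<not> cdp_variant (sel X) (\<alpha> i)" for i
          using removed_cdp_not_in_chain[of P F R \<Pi> T n "sel X" \<alpha> \<sigma> D i] X True chain(1) assms
          unfolding XP by linarith
        moreover have "\<forall>i. \<exists>\<beta> \<in> P. cdp_variant \<beta> (\<alpha> i)"
          using chain(1) unfolding XP cdp_chain_with.simps by (elim conjE)
        ultimately have "\<forall>i. \<exists>\<beta> \<in> P - {sel X}. cdp_variant \<beta> (\<alpha> i)" by blast
        then have "infinite_minimal_chain (P - {sel X}, (F, R), \<Pi>, T) \<alpha>"
          by (rule infinite_minimal_chain_change_cdps[OF chain[unfolded XP]])
        moreover have "(P - {sel X}, (F, R), \<Pi>, T) \<in> SCP n sel X"
          using True unfolding XP by (simp add: Let_def del: scp_applicable.simps)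
        ultimately show False using fin unfolding finite_problem_def by blast
      qed
    next
      case False
      then have "X \<in> SCP n sel X"
        unfolding XP by (auto simp: Let_def simp del: scp_applicable.simps)
      then show ?thesis using fin by blast
    qed
  qed
  show "complete_processor (SCP n sel)"
    unfolding complete_processor_def
  proof (intro allI impI)
    fix X :: "('f, 'v) cdp_problem"
    assume "\<exists>Y \<in> SCP n sel X. infinite_problem Y"
    then obtain Y \<alpha> where Y: "Y \<in> SCP n sel X" "infinite_minimal_chain Y \<alpha>"
      unfolding infinite_problem_def finite_problem_def by blast
    obtain P F R \<Pi> T where XP: "X = (P, (F, R), \<Pi>, T)" by (cases X) auto
    have "Y = X \<or> Y = (P - {sel X}, (F, R), \<Pi>, T)"
      using Y(1) unfolding XP by (simp add: Let_def del: scp_applicable.simps split: if_splits)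
    then obtain Q where Q: "Q \<subseteq> P" "Y = (Q, (F, R), \<Pi>, T)" unfolding XP by blast
    obtain \<sigma> D where chain: "cdp_chain_with Y \<alpha> \<sigma> D" "minimal_with Y \<alpha> \<sigma> D"
      using Y(2) unfolding infinite_minimal_chain_def by blast
    have "\<forall>i. \<exists>\<beta> \<in> Q. cdp_variant \<beta> (\<alpha> i)"
      using chain(1) unfolding Q(2) cdp_chain_with.simps by (elim conjE)
    then have "\<forall>i. \<exists>\<beta> \<in> P. cdp_variant \<beta> (\<alpha> i)" using Q(1) by blast
    then have "infinite_minimal_chain X \<alpha>"
      unfolding XP by (rule infinite_minimal_chain_change_cdps[OF chain[unfolded Q(2)]])
    then show "infinite_problem X" unfolding infinite_problem_def finite_problem_def by blast
  qed
qed

end
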